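(* Let $d\ge1$, let $a:\mathbb R^d\to[0,\infty)$ be a bounded, continuous, even, integrable function with $\int_{\mathbb R^d}a(x)\,dx=1$, and let $(L_0u)(x)=\int_{\mathbb R^d}a(x-y)(u(y)-u(x))\,dy$. Let $m>0$ be a constant and let $f\in L^1(\mathbb R^d)\cap C_b(\mathbb R^d)$ with $f\ge0$, $f\not\equiv0$. Let $u(x,t)$ be the solution of the Cauchy problem $$\frac{\partial u}{\partial t}=L_0u-mu+f(x),\qquad u(x,0)=0,$$ and let $$\hat u(x)=(m-L_0)^{-1}f(x)=\frac1{1+m}\Big(f(x)+\int_{\mathbb R^d}G_m(x-y)f(y)\,dy\Big)$$ be the stationary solution. Then: (i) $\|u(\cdot,t)-\hat u\|\to0$ as $t\to\infty$, both in the $L^2(\mathbb R^d)$ norm and in the $C_b(\mathbb R^d)$ (supremum) norm. (ii) Suppose there are $\alpha,\alpha_1>0$ and positive constants $b_\pm$, $b_\pm'$ such that $b_-(1+|x|)^{-(d+\alpha)}\le a(x)\le b_+(1+|x|)^{-(d+\alpha)}$ and $b_-'(1+|x|)^{-(d+\alpha_1)}\le f(x)\le b_+'(1+|x|)^{-(d+\alpha_1)}$ for all $x\in\mathbb R^d$. Then, with $\tilde\alpha=\min(\alpha,\alpha_1)$, there are positive constants $c_-\le c_+$ such that $$c_-(1+|x|)^{-(d+\tilde\alpha)}\le\hat u(x)\le c_+(1+|x|)^{-(d+\tilde\alpha)}\quad\text{for all }x\in\mathbb R^d,$$ and $0\le u(x,t)\le\hat u(x)$ for all $x\in\mathbb R^d$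 and $t>0$. (iii) Suppose there are positive constants $b,b',\delta,\delta'$ such that $a(x)\le b\,e^{-\delta|x|}$ and $f(x)\le b'e^{-\delta'|x|}$ for all $x\in\mathbb R^d$. Then $\hat u$, and $u(\cdot,t)$ for every $t>0$, decay exponentially, i.e. each is bounded by $Ke^{-\mu|x|}$ on $\mathbb R^d$ for some positive constants $K,\mu$.
   Context: For $m>0$, $G_m(x)=\sum_{k=1}^\infty(1+m)^{-k}a_k(x)$, where $a_1=a$ and $a_{k+1}(x)=\int_{\mathbb R^d}a(x-y)a_k(y)\,dy$. $C_b(\mathbb R^d)$ is the space of bounded continuous functions. $L_0$ is a bounded operator on $L^2(\mathbb R^d)$ and on $C_b(\mathbb R^d)$; the solution of the Cauchy problem is $u(\cdot,t)=\int_0^te^{s(L_0-m)}f\,ds$. *)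

theory Defs
  imports "HOL-Analysis.Analysis"
begin

text \<open>The space \<open>C\<^sub>b(\<real>\<^sup>d)\<close> with the supremum norm is the library type \<^typ>\<open>'a \<Rightarrow>\<^sub>C real\<close>, and
  \<^term>\<open>bcontfun :: ('a::euclidean_space \<Rightarrow> real) set\<close> is the corresponding set of functions.\<close>

instance bcontfun :: (metric_space, banach) banach ..

definition L0 :: "('a::euclidean_space \<Rightarrow> real) \<Rightarrow> ('a \<Rightarrow> real) \<Rightarrow> 'a \<Rightarrow> real" where
  "L0 a u x = (LINT y|lborel. a (x - y) * (u y - u x))"

text \<open>\<^const>\<open>Bcontfun\<close> is unspecified outside \<^const>\<open>bcontfun\<close>; see \<open>L0_in_bcontfun\<close> below.\<close>

definition L0_Cb :: "('a::euclidean_space \<Rightarrow> real) \<Rightarrow> ('a \<Rightarrow>\<^sub>C real) \<Rightarrow> ('a \<Rightarrow>\<^sub>C real)" where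
  "L0_Cb a v = Bcontfun (L0 a (apply_bcontfun v))"

text \<open>The operator exponential \<open>e\<^sup>s\<^sup>A\<close> applied to \<open>v\<close>, as a norm-convergent series
  (for a bounded linear operator \<open>A\<close>).\<close>

definition op_exp :: "('b::banach \<Rightarrow> 'b) \<Rightarrow> real \<Rightarrow> 'b \<Rightarrow> 'b" where
  "op_exp A s v = (\<Sum>n. (s ^ n / fact n) *\<^sub>R (A ^^ n) v)"

definition cauchy_sol ::
    "('a::euclidean_space \<Rightarrow> real) \<Rightarrow> real \<Rightarrow> ('a \<Rightarrow>\<^sub>C real) \<Rightarrow> real \<Rightarrow> ('a \<Rightarrow>\<^sub>C real)" where
  "cauchy_sol a m f t = integral {0..t} (\<lambda>s. op_exp (\<lambda>v. L0_Cb a v - m *\<^sub>R v) s f)"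

definition is_cauchy_solution_Cb ::
    "('a::euclidean_space \<Rightarrow> real) \<Rightarrow> real \<Rightarrow> ('a \<Rightarrow>\<^sub>C real) \<Rightarrow> (real \<Rightarrow> ('a \<Rightarrow>\<^sub>C real)) \<Rightarrow> bool" where
  "is_cauchy_solution_Cb a m f u \<longleftrightarrow>
     u 0 = 0 \<and>
     (\<forall>t\<ge>0. (u has_vector_derivative (L0_Cb a (u t) - m *\<^sub>R u t + f)) (at t within {0..}))"

definition square_integrable :: "('a::euclidean_space \<Rightarrow> real) \<Rightarrow> bool" where
  "square_integrable g \<longleftrightarrow> g \<in> borel_measurable lborel \<and> integrable lborel (\<lambda>x. (g x)\<^sup>2)"

definition L2_norm :: "('a::euclidean_space \<Rightarrow> real) \<Rightarrow> real" where
  "L2_norm g = sqrt (LINT x|lborel. (g x)\<^sup>2)"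

text \<open>The same Cauchy problem in \<open>L\<^sup>2(\<real>\<^sup>d)\<close>, for representatives of the classes; the time derivative
  is the limit of difference quotients in the \<open>L\<^sup>2\<close> norm.\<close>

definition is_cauchy_solution_L2 ::
    "('a::euclidean_space \<Rightarrow> real) \<Rightarrow> real \<Rightarrow> ('a \<Rightarrow> real) \<Rightarrow> (real \<Rightarrow> 'a \<Rightarrow> real) \<Rightarrow> bool" where
  "is_cauchy_solution_L2 a m f u \<longleftrightarrow>
     (\<forall>t\<ge>0. square_integrable (u t)) \<and>
     (AE x in lborel. u 0 x = 0) \<and>
     (\<forall>t\<ge>0. ((\<lambda>s. L2_norm (\<lambda>x. (u s x - u t x) / (s - t) - (L0 a (u t) x - m * u t x + f x)))
               \<longlongrightarrow> 0) (at t within {0..}))"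

text \<open>Convolution powers with shifted index: \<open>conv_pow a k\<close> is \<open>a\<^bsub>k+1\<^esub>\<close>.\<close>

primrec conv_pow :: "('a::euclidean_space \<Rightarrow> real) \<Rightarrow> nat \<Rightarrow> 'a \<Rightarrow> real" where
  "conv_pow a 0 = a"
| "conv_pow a (Suc k) = (\<lambda>x. LINT y|lborel. a (x - y) * conv_pow a k y)"

definition G_kernel :: "('a::euclidean_space \<Rightarrow> real) \<Rightarrow> real \<Rightarrow> 'a \<Rightarrow> real" where
  "G_kernel a m x = (\<Sum>k. conv_pow a k x / (1 + m) ^ (k + 1))"

definition u_hat :: "('a::euclidean_space \<Rightarrow> real) \<Rightarrow> real \<Rightarrow> ('a \<Rightarrow> real) \<Rightarrow> 'a \<Rightarrow> real" where
  "u_hat a m f x = 1 / (1 + m) * (f x + (LINT y|lborel. G_kernel a m (x - y) * f y))"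

lemma L0_in_bcontfun:
  fixes a v :: "'a::euclidean_space \<Rightarrow> real"
  assumes a: "integrable lborel a" and v: "v \<in> bcontfun"
  shows "L0 a v \<in> bcontfun"
proof -
  have cv: "continuous_on UNIV v" and "bounded (range v)"
    using v by (auto simp: bcontfun_def)
  then obtain B where B: "\<And>x. \<bar>v x\<bar> \<le> B"
    by (auto simp: bounded_iff)
  have mv[measurable]: "v \<in> borel_measurable borel"
    using cv by (rule borel_measurable_continuous_onI)
  have ma[measurable]: "a \<in> borel_measurable borel"
    using a by (auto dest: borel_measurable_integrable)
  have shift: "L0 a v x = (LINT z|lborel. a z * (v (x - z) - v x))" for x
  proof -
    have "(LINT y|lborel. a (x - y) * (v y - v x))
        = (LINT y|density (distr lborel borel (\<lambda>z. x + (-1) *\<^sub>R z)) (\<lambda>_. ennreal (\<bar>-1\<bar> ^ DIM('a))). a (x - y) * (v y - v x))"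
      by (subst lborel_affine[of "-1" x]) auto
    also have "\<dots> = (LINT y|distr lborel borel (\<lambda>z. x + (-1) *\<^sub>R z). a (x - y) * (v y - v x))"
      by (simp add: density_1)
    also have "\<dots> = (LINT z|lborel. a z * (v (x - z) - v x))"
      by (subst integral_distr) auto
    finally show ?thesis unfolding L0_def .
  qed
  have bd: "\<bar>a z * (v (x - z) - v x)\<bar> \<le> \<bar>a z\<bar> * (2 * B)" for x z
    using B[of "x - z"] B[of x] by (auto simp: abs_mult intro!: mult_left_mono)
  have dom: "integrable lborel (\<lambda>z. \<bar>a z\<bar> * (2 * B))"
    using a by auto
  have "continuous_on UNIV (L0 a v)"
  proof (unfold continuous_on_sequentially comp_def, intro allI ballI impI)
    fix X :: "nat \<Rightarrow> 'a" and x assume "(\<forall>n. X n \<in> UNIV) \<and> X \<longlonglongrightarrow> x"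
    then have X: "X \<longlonglongrightarrow> x" by simp
    have ic: "isCont v y" for y
      using cv by (simp add: continuous_on_eq_continuous_at)
    show "(\<lambda>n. L0 a v (X n)) \<longlonglongrightarrow> L0 a v x"
      unfolding shift
    proof (rule integral_dominated_convergence[OF _ _ dom])
      show "AE z in lborel. (\<lambda>n. a z * (v (X n - z) - v (X n))) \<longlonglongrightarrow> a z * (v (x - z) - v x)"
        by (intro AE_I2 tendsto_intros isCont_tendsto_compose[OF ic] X)
    qed (use bd in auto)
  qed
  moreover have "\<bar>L0 a v x\<bar> \<le> (LINT z|lborel. \<bar>a z\<bar> * (2 * B))" for x
  proof -
    have "integrable lborel (\<lambda>z. a z * (v (x - z) - v x))"
      by (rule Bochner_Integration.integrable_bound[OF dom]) (use bd[of _ x] in \<open>auto intro: order_trans[OF _ abs_ge_self]\<close>)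
    then show ?thesis unfolding shift
      using bd by (intro order_trans[OF integral_abs_bound] integral_mono[OF _ dom]) auto
  qed
  ultimately show ?thesis
    by (auto simp: bcontfun_def bounded_iff)
qed

end

theory Submission
  imports Defs
begin

text \<open>With \<open>A v = a * v\<close> and \<open>c = 1 + m\<close> one has \<open>L\<^sub>0 - m = A - c\<close>, and \<open>A\<close> is a contraction on \<open>C\<^sub>b\<close>, \<open>L\<^sup>1\<close> and
  \<open>L\<^sup>2\<close>. Hence \<open>u(t) = \<Sum>\<^sub>k p\<^sub>k(t) A\<^sup>k f\<close> with \<open>p\<^sub>k(t) = \<integral>\<^sub>0\<^sup>t e\<^bsup>-cs\<^esup> s\<^sup>k / k! ds\<close>, and the stationary solution is
  the limit \<open>\<Sum>\<^sub>k c\<^bsup>-(k+1)\<^esup> A\<^sup>k f\<close>. As \<open>0 \<le> p\<^sub>k(t) \<le> c\<^bsup>-(k+1)\<^esup>\<close> and \<open>\<Sum>\<^sub>k (c\<^bsup>-(k+1)\<^esup> - p\<^sub>k(t)) = e\<^bsup>-mt\<^esup> / m\<close>, this gives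
  \<open>0 \<le> u \<le> uh\<close> and convergence in \<open>C\<^sub>b\<close>; since the \<open>L\<^sup>1\<close> norms stay bounded, \<open>\<parallel>v\<parallel>\<^sub>2\<^sup>2 \<le> \<parallel>v\<parallel>\<^sub>\<infinity> \<parallel>v\<parallel>\<^sub>1\<close> yields the
  \<open>L\<^sup>2\<close> statements. Decay follows by comparison: a positive weight \<open>w\<close> with \<open>A w \<le> \<kappa> w\<close>, \<open>\<kappa> < c\<close>, and \<open>f \<le> C w\<close>
  satisfies \<open>A\<^sup>k f \<le> C \<kappa>\<^sup>k w\<close>, hence \<open>uh \<le> C w / (c - \<kappa>)\<close>.\<close>

section \<open>Convolution with a probability density\<close>

text \<open>The power series of the exponential of \<open>L0 - m\<close> shows neither sign nor
  order. Splitting off the scalar part puts every negative sign into e^{-cs}, and what remains is a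
  series in a positive operator with nonnegative coefficients. No Banach space L^2 is built. A
  single function with values in C_b serves both norms, and its L^2 properties come from
  interpolation. Only uniqueness, for the evolution and for the resolvent equation, is argued in L^2
  itself, for representatives, with Jensen's inequality supplying the contraction. In the comparison
  argument the slack above 1 must stay below m, which may be tiny, so a fixed weight need not
  suffice. For a power weight the obstacle is the mass far from x: it contributes about a(x) times
  the integral of w, which can be of the same order as w(x). Capping the weight at a small level l
  makes this mass small and leaves the decay at infinity unchanged, so the cap costs only a
  constant. For an exponential weight a small rate does the same service.\<close>

lemma lborel_distr_reflect:
  fixes x :: "'a::euclidean_space"
  shows "distr lborel borel (\<lambda>z. x - z) = lborel"
proof -
  have "lborel = density (distr lborel borel (\<lambda>z. x + (-1) *\<^sub>R z)) (\<lambda>_. ennreal (\<bar>-1\<bar> ^ DIM('a)))"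
    by (subst lborel_affine[of "-1" x]) auto
  then show ?thesis by (simp add: density_1)
qed

lemma nn_integral_reflect:
  fixes x :: "'a::euclidean_space"
  assumes [measurable]: "h \<in> borel_measurable borel"
  shows "(\<integral>\<^sup>+y. h (x - y) \<partial>lborel) = (\<integral>\<^sup>+y. h y \<partial>lborel)"
proof -
  have "(\<integral>\<^sup>+y. h y \<partial>lborel) = (\<integral>\<^sup>+y. h y \<partial>distr lborel borel (\<lambda>z. x - z))"
    by (simp add: lborel_distr_reflect)
  also have "\<dots> = (\<integral>\<^sup>+y. h (x - y) \<partial>lborel)"
    by (subst nn_integral_distr) auto
  finally show ?thesis by simp
qed

lemma integrable_reflect:
  fixes x :: "'a::euclidean_space" and h :: "'a \<Rightarrow> real"
  assumes "integrable lborel h"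
  shows "integrable lborel (\<lambda>y. h (x - y))"
proof -
  have "integrable (distr lborel borel (\<lambda>z. x - z)) h"
    using assms by (simp add: lborel_distr_reflect)
  then show ?thesis by (rule integrable_distr[rotated]) auto
qed

lemma integral_reflect_at:
  fixes x :: "'a::euclidean_space" and h :: "'a \<Rightarrow> real"
  assumes [measurable]: "h \<in> borel_measurable borel"
  shows "(LINT y|lborel. h (x - y)) = (LINT y|lborel. h y)"
proof -
  have "(LINT y|lborel. h y) = (LINT y|distr lborel borel (\<lambda>z. x - z). h y)"
    by (simp add: lborel_distr_reflect)
  also have "\<dots> = (LINT y|lborel. h (x - y))"
    by (subst integral_distr) auto
  finally show ?thesis by simp
qed

text \<open>A translation is the composite of two reflections, y to -y and then z to -x - z, so the
  reflection lemma applied twice suffices.\<close>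

lemma integrable_shift:
  fixes x :: "'a::euclidean_space" and h :: "'a \<Rightarrow> real"
  assumes "integrable lborel h"
  shows "integrable lborel (\<lambda>y. h (y - x))"
  using integrable_reflect[OF integrable_reflect[OF assms, of "-x"], of 0] by (simp add: algebra_simps)

lemma integral_shift:
  fixes x :: "'a::euclidean_space" and h :: "'a \<Rightarrow> real"
  assumes [measurable]: "h \<in> borel_measurable borel"
  shows "(LINT y|lborel. h (y - x)) = (LINT y|lborel. h y)"
  using integral_reflect_at[of "\<lambda>y. h (- x - y)" 0] integral_reflect_at[OF assms, of "-x"]
  by (simp add: algebra_simps)

lemma integrable_mult_bounded:
  fixes g h :: "'b \<Rightarrow> real"
  assumes "integrable M h" "g \<in> borel_measurable M" "\<And>x. \<bar>g x\<bar> \<le> B"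
  shows "integrable M (\<lambda>x. g x * h x)"
proof (rule Bochner_Integration.integrable_bound)
  show "integrable M (\<lambda>x. B * \<bar>h x\<bar>)" using assms(1) by auto
  have "0 \<le> B" using assms(3)[of undefined] by linarith
  then show "AE x in M. norm (g x * h x) \<le> norm (B * \<bar>h x\<bar>)"
    using assms(3) by (auto simp: abs_mult intro!: mult_right_mono)
qed (use assms in auto)

section \<open>Convolution and Fubini's theorem\<close>

definition conv :: "('a::euclidean_space \<Rightarrow> real) \<Rightarrow> ('a \<Rightarrow> real) \<Rightarrow> 'a \<Rightarrow> real" where
  "conv g v x = (LINT y|lborel. g (x - y) * v y)"

lemma borel_measurable_conv [measurable (raw)]:
  assumes [measurable]: "g \<in> borel_measurable borel" "v \<in> borel_measurable borel"
  shows "conv g v \<in> borel_measurable borel"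
  unfolding conv_def by measurable

text \<open>Integrating in x first separates the factors: by translation invariance the inner
  integral of the absolute value is the L^1 norm of g times |v y|.\<close>

lemma integrable_pair_conv:
  fixes g v :: "'a::euclidean_space \<Rightarrow> real"
  assumes g: "integrable lborel g" and v: "integrable lborel v"
  shows "integrable (lborel \<Otimes>\<^sub>M lborel) (\<lambda>(y, x). g (x - y) * v y)"
proof -
  have [measurable]: "g \<in> borel_measurable borel" "v \<in> borel_measurable borel"
    using g v by (auto dest: borel_measurable_integrable)
  show ?thesis
  proof (rule lborel_pair.Fubini_integrable)
    have "(LINT x|lborel. norm (case (y, x) of (y, x) \<Rightarrow> g (x - y) * v y)) = (LINT x|lborel. \<bar>g x\<bar>) * \<bar>v y\<bar>" for y
      using integral_shift[of "\<lambda>x. \<bar>g x\<bar>" y] by (simp add: abs_mult)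
    then show "integrable lborel (\<lambda>y. LINT x|lborel. norm (case (y, x) of (y, x) \<Rightarrow> g (x - y) * v y))"
      using v by simp
    show "AE y in lborel. integrable lborel (\<lambda>x. case (y, x) of (y, x) \<Rightarrow> g (x - y) * v y)"
      using integrable_shift[OF g] by auto
  qed measurable
qed

lemma
  fixes g v :: "'a::euclidean_space \<Rightarrow> real"
  assumes g: "integrable lborel g" and v: "integrable lborel v"
  shows integrable_conv: "integrable lborel (conv g v)"
    and integral_conv: "(LINT x|lborel. conv g v x) = (LINT x|lborel. g x) * (LINT x|lborel. v x)"
proof -
  have [measurable]: "g \<in> borel_measurable borel"
    using g by (auto dest: borel_measurable_integrable)
  note P = integrable_pair_conv[OF g v]
  show "integrable lborel (conv g v)"
    using lborel_pair.integrable_snd[OF P] by (simp add: conv_def[abs_def])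
  have "(LINT x|lborel. conv g v x) = (LINT y|lborel. LINT x|lborel. g (x - y) * v y)"
    using lborel_pair.Fubini_integral[OF P] by (simp add: conv_def)
  then show "(LINT x|lborel. conv g v x) = (LINT x|lborel. g x) * (LINT x|lborel. v x)"
    by (simp add: integral_shift)
qed

text \<open>Boundedness of \<open>a\<close> makes the double integrand absolutely integrable for
  every fixed x, so Fubini applies pointwise and the two sides agree as functions, not merely almost
  everywhere.\<close>

lemma conv_assoc:
  fixes a g f :: "'a::euclidean_space \<Rightarrow> real"
  assumes [measurable]: "a \<in> borel_measurable borel" and a: "\<And>x. \<bar>a x\<bar> \<le> B"
    and g: "integrable lborel g" and f: "integrable lborel f"
  shows "conv (conv a g) f = conv a (conv g f)"
proof
  fix x
  have [measurable]: "g \<in> borel_measurable borel" "f \<in> borel_measurable borel"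
    using g f by (auto dest: borel_measurable_integrable)
  have P: "integrable (lborel \<Otimes>\<^sub>M lborel) (\<lambda>(y, w). a (x - w) * (g (w - y) * f y))"
    using integrable_mult_bounded[OF integrable_pair_conv[OF g f], of "\<lambda>(y, w). a (x - w)" B] a
    by (auto simp: case_prod_beta')
  have "conv (conv a g) f x = (LINT y|lborel. LINT w|lborel. a (x - w) * (g (w - y) * f y))"
    unfolding conv_def
  proof (intro Bochner_Integration.integral_cong refl)
    fix y
    have "(LINT z|lborel. a (x - y - z) * g z) = (LINT w|lborel. a (x - w) * g (w - y))"
      using integral_shift[of "\<lambda>z. a (x - y - z) * g z" y] by (simp add: algebra_simps)
    then show "(LINT z|lborel. a (x - y - z) * g z) * f y = (LINT w|lborel. a (x - w) * (g (w - y) * f y))"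
      by (simp flip: mult.assoc)
  qed
  also have "\<dots> = (LINT w|lborel. LINT y|lborel. a (x - w) * (g (w - y) * f y))"
    using lborel_pair.Fubini_integral[OF P] by simp
  also have "\<dots> = conv a (conv g f) x"
    by (simp add: conv_def)
  finally show "conv (conv a g) f x = conv a (conv g f) x" .
qed

section \<open>Averaging against a probability density\<close>

locale kernel =
  fixes a :: "'a::euclidean_space \<Rightarrow> real"
  assumes nonneg: "\<And>x. 0 \<le> a x"
    and bounded: "bounded (range a)"
    and int: "integrable lborel a"
    and int_1: "(LINT x|lborel. a x) = 1"
begin

lemma borel [measurable]: "a \<in> borel_measurable borel"
  using int by (auto dest: borel_measurable_integrable)

definition amax where "amax = (SUP x. a x)"

lemma le_amax: "a x \<le> amax"
  unfolding amax_def by (rule cSUP_upper) (auto intro: bounded_imp_bdd_above bounded)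

lemma abs_le_amax: "\<bar>a x\<bar> \<le> amax" "\<bar>a x\<bar> \<le> \<bar>amax\<bar>"
  using le_amax[of x] nonneg[of x] by auto

lemma integrable_reflected: "integrable lborel (\<lambda>y. a (x - y))"
  by (rule integrable_reflect[OF int])

lemma integral_reflected: "(LINT y|lborel. a (x - y)) = 1"
  using int_1 by (simp add: integral_reflect_at)

lemma integrable_conv_integrand:
  assumes "integrable lborel v"
  shows "integrable lborel (\<lambda>y. a (x - y) * v y)"
  by (rule integrable_mult_bounded[OF assms]) (auto intro: abs_le_amax)

lemma integrable_conv_integrand_bounded:
  assumes "v \<in> borel_measurable borel" "\<And>x. \<bar>v x\<bar> \<le> B"
  shows "integrable lborel (\<lambda>y. a (x - y) * v y)"
  using integrable_mult_bounded[OF integrable_reflected, of v B x] assms by (simp add: mult.commute)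

lemma conv_mono:
  assumes "integrable lborel (\<lambda>y. a (x - y) * v y)" "integrable lborel (\<lambda>y. a (x - y) * w y)"
    and "\<And>y. v y \<le> w y"
  shows "conv a v x \<le> conv a w x"
  unfolding conv_def using assms by (intro integral_mono) (auto intro: mult_left_mono nonneg)

lemma conv_bound:
  assumes "v \<in> borel_measurable borel" "\<And>x. \<bar>v x\<bar> \<le> B"
  shows "\<bar>conv a v x\<bar> \<le> B"
proof -
  have "\<bar>conv a v x\<bar> \<le> (LINT y|lborel. \<bar>a (x - y) * v y\<bar>)"
    unfolding conv_def by (rule integral_abs_bound)
  also have "\<dots> \<le> (LINT y|lborel. a (x - y) * B)"
    using integrable_norm[OF integrable_conv_integrand_bounded[OF assms, of x]] integrable_reflected[of x] nonneg assms(2)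
    by (intro integral_mono) (auto simp: abs_mult intro!: mult_left_mono)
  finally show ?thesis by (simp add: integral_reflected)
qed

text \<open>The bound |v| <= 1 + v^2 splits the integrand into two parts: \<open>a (x - y)\<close>
  is integrable, and \<open>a\<close> is bounded against the integrable v^2. This holds at every x,
  so L^2 representatives can be convolved pointwise.\<close>

lemma integrable_conv_integrand_L2:
  assumes "square_integrable v"
  shows "integrable lborel (\<lambda>y. a (x - y) * v y)"
proof (rule Bochner_Integration.integrable_bound)
  have v: "integrable lborel (\<lambda>y. (v y)\<^sup>2)" and [measurable]: "v \<in> borel_measurable borel"
    using assms by (auto simp: square_integrable_def)
  show "integrable lborel (\<lambda>y. a (x - y) + a (x - y) * (v y)\<^sup>2)"
    by (intro Bochner_Integration.integrable_add integrable_reflected integrable_conv_integrand v)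
  have "\<bar>v y\<bar> \<le> 1 + (v y)\<^sup>2" for y
    using sum_squares_bound[of 1 "\<bar>v y\<bar>"] by (simp add: power2_eq_square)
  then have "a (x - y) * \<bar>v y\<bar> \<le> a (x - y) * (1 + (v y)\<^sup>2)" for y
    by (rule mult_left_mono) (rule nonneg)
  then show "AE y in lborel. norm (a (x - y) * v y) \<le> norm (a (x - y) + a (x - y) * (v y)\<^sup>2)"
    using nonneg by (auto simp: abs_mult algebra_simps)
qed (use assms in \<open>auto simp: square_integrable_def\<close>)

text \<open>Jensen's inequality for the probability density \<open>a (x - \<cdot>)\<close>.\<close>

lemma conv_square_le:
  assumes "square_integrable v"
  shows "(conv a v x)\<^sup>2 \<le> conv a (\<lambda>y. (v y)\<^sup>2) x"
proof -
  define \<tau> where "\<tau> = conv a v x"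
  have v: "integrable lborel (\<lambda>y. (v y)\<^sup>2)"
    using assms by (auto simp: square_integrable_def)
  note i = integrable_conv_integrand_L2[OF assms, of x] integrable_conv_integrand[OF v, of x]
    integrable_reflected[of x]
  \<comment> \<open>This integral is the variance of v under the density a(x - .), whose mean is
    \<tau>; expanding the square gives the claim.\<close>
  have "0 \<le> (LINT y|lborel. a (x - y) * (v y - \<tau>)\<^sup>2)"
    by (intro integral_nonneg_AE) (auto simp: nonneg)
  also have "(\<lambda>y. a (x - y) * (v y - \<tau>)\<^sup>2)
      = (\<lambda>y. a (x - y) * (v y)\<^sup>2 - (2 * \<tau>) * (a (x - y) * v y) + \<tau>\<^sup>2 * a (x - y))"
    by (auto simp: power2_eq_square algebra_simps)
  also have "(LINT y|lborel. a (x - y) * (v y)\<^sup>2 - (2 * \<tau>) * (a (x - y) * v y) + \<tau>\<^sup>2 * a (x - y))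
      = conv a (\<lambda>y. (v y)\<^sup>2) x - (2 * \<tau>) * conv a v x + \<tau>\<^sup>2"
    unfolding conv_def using i by (simp add: integral_reflected)
  finally show ?thesis by (simp add: \<tau>_def power2_eq_square)
qed

text \<open>Jensen's inequality is integrated over x; convolution with a density of mass one
  preserves the integral of v^2.\<close>

lemma
  assumes "square_integrable v"
  shows square_integrable_conv: "square_integrable (conv a v)"
    and integral_conv_square_le: "(LINT x|lborel. (conv a v x)\<^sup>2) \<le> (LINT x|lborel. (v x)\<^sup>2)"
proof -
  have v: "integrable lborel (\<lambda>y. (v y)\<^sup>2)" and [measurable]: "v \<in> borel_measurable borel"
    using assms by (auto simp: square_integrable_def)
  note ic = integrable_conv[OF int v]
  have I: "integrable lborel (\<lambda>x. (conv a v x)\<^sup>2)"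
    by (rule Bochner_Integration.integrable_bound[OF ic])
      (auto intro!: order_trans[OF conv_square_le[OF assms]])
  then show "square_integrable (conv a v)" by (simp add: square_integrable_def)
  have "(LINT x|lborel. (conv a v x)\<^sup>2) \<le> (LINT x|lborel. conv a (\<lambda>y. (v y)\<^sup>2) x)"
    by (rule integral_mono[OF I ic]) (rule conv_square_le[OF assms])
  then show "(LINT x|lborel. (conv a v x)\<^sup>2) \<le> (LINT x|lborel. (v x)\<^sup>2)"
    using integral_conv[OF int v] by (simp add: int_1)
qed

lemma L0_eq_conv:
  assumes "integrable lborel (\<lambda>y. a (x - y) * v y)"
  shows "L0 a v x = conv a v x - v x"
  using assms integrable_reflected[of x]
  by (simp add: L0_def conv_def right_diff_distrib integral_reflected)

end

section \<open>Linear evolution equations in Banach spaces\<close>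

text \<open>One termwise differentiation result covers both the operator exponential and the Duhamel
  series. Only the derivative coefficients need a summable majorant, locally uniformly in t;
  convergence of the series itself spreads from the single time 0.\<close>

lemma
  fixes X :: "nat \<Rightarrow> 'b::banach" and c c' :: "nat \<Rightarrow> real \<Rightarrow> real"
  assumes der: "\<And>n t. (c n has_real_derivative c' n t) (at t)"
    and bound: "\<And>R n t. \<bar>t\<bar> < R \<Longrightarrow> \<bar>c' n t\<bar> * norm (X n) \<le> M R n"
    and M: "\<And>R. summable (M R)"
    and s0: "summable (\<lambda>n. c n 0 *\<^sub>R X n)"
  shows summable_scaleR_series: "summable (\<lambda>n. c n t *\<^sub>R X n)"
    and has_vector_derivative_suminf:
      "((\<lambda>t. \<Sum>n. c n t *\<^sub>R X n) has_vector_derivative (\<Sum>n. c' n t *\<^sub>R X n)) (at t)"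
proof -
  \<comment> \<open>The radius is chosen so that the open interval contains both t and 0, the point
    where convergence is known.\<close>
  define R where "R = \<bar>t\<bar> + 1"
  define S where "S = {-R<..<R}"
  have S: "open S" "convex S" "t \<in> S" "0 \<in> S"
    by (auto simp: S_def R_def)
  have U: "uniform_limit S (\<lambda>n x. \<Sum>i<n. c' i x *\<^sub>R X i) (\<lambda>x. \<Sum>i. c' i x *\<^sub>R X i) sequentially"
    by (rule Weierstrass_m_test[OF _ M[of R]]) (use bound[of _ R] in \<open>auto simp: S_def\<close>)
  have "\<exists>g. \<forall>x\<in>S. (\<lambda>n. c n x *\<^sub>R X n) sums g x \<and>
      (g has_derivative (\<lambda>h. h *\<^sub>R (\<Sum>n. c' n x *\<^sub>R X n))) (at x within S)"
  proof (rule has_derivative_series[where f = "\<lambda>n x. c n x *\<^sub>R X n" and f' = "\<lambda>n x h. h *\<^sub>R (c' n x *\<^sub>R X n)"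
      and g' = "\<lambda>x h. h *\<^sub>R (\<Sum>n. c' n x *\<^sub>R X n)", OF S(2) _ _ S(4) summable_sums[OF s0]])
    fix n x assume "x \<in> S"
    have "((\<lambda>x. c n x *\<^sub>R X n) has_vector_derivative c' n x *\<^sub>R X n) (at x within S)"
      using has_vector_derivative_scaleR[OF der[of n x] has_vector_derivative_const[of "X n"]]
      by (simp add: has_vector_derivative_at_within)
    then show "((\<lambda>x. c n x *\<^sub>R X n) has_derivative (\<lambda>h. h *\<^sub>R (c' n x *\<^sub>R X n))) (at x within S)"
      by (simp add: has_vector_derivative_def)
  next
    fix e :: real assume "e > 0"
    have "\<forall>\<^sub>F n in sequentially. \<forall>x\<in>S. dist (\<Sum>i<n. c' i x *\<^sub>R X i) (\<Sum>i. c' i x *\<^sub>R X i) < e"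
      by (rule uniform_limitD[OF U \<open>e > 0\<close>])
    then show "\<forall>\<^sub>F n in sequentially. \<forall>x\<in>S. \<forall>h. norm ((\<Sum>i<n. h *\<^sub>R (c' i x *\<^sub>R X i)) - h *\<^sub>R (\<Sum>n. c' n x *\<^sub>R X n)) \<le> e * norm h"
    proof (eventually_elim, intro ballI allI)
      fix n x and h :: real
      assume *: "\<forall>x\<in>S. dist (\<Sum>i<n. c' i x *\<^sub>R X i) (\<Sum>i. c' i x *\<^sub>R X i) < e" and "x \<in> S"
      have "norm ((\<Sum>i<n. h *\<^sub>R (c' i x *\<^sub>R X i)) - h *\<^sub>R (\<Sum>n. c' n x *\<^sub>R X n))
          = \<bar>h\<bar> * norm ((\<Sum>i<n. c' i x *\<^sub>R X i) - (\<Sum>n. c' n x *\<^sub>R X n))"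
        by (simp only: flip: scaleR_right.sum scaleR_right_diff_distrib norm_scaleR)
      also have "\<dots> \<le> \<bar>h\<bar> * e"
        using * \<open>x \<in> S\<close> by (intro mult_left_mono) (auto simp: dist_norm less_imp_le)
      finally show "norm ((\<Sum>i<n. h *\<^sub>R (c' i x *\<^sub>R X i)) - h *\<^sub>R (\<Sum>n. c' n x *\<^sub>R X n)) \<le> e * norm h"
        by (simp add: mult.commute)
    qed
  qed
  then obtain g where g: "\<And>x. x \<in> S \<Longrightarrow> (\<lambda>n. c n x *\<^sub>R X n) sums g x"
    and g': "\<And>x. x \<in> S \<Longrightarrow> (g has_vector_derivative (\<Sum>n. c' n x *\<^sub>R X n)) (at x within S)"
    by (auto simp: has_vector_derivative_def)
  show "summable (\<lambda>n. c n t *\<^sub>R X n)"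
    using g[OF S(3)] by (rule sums_summable)
  have "(g has_vector_derivative (\<Sum>n. c' n t *\<^sub>R X n)) (at t)"
    using g'[OF S(3)] by (simp only: at_within_open[OF S(3,1)])
  then show "((\<lambda>t. \<Sum>n. c n t *\<^sub>R X n) has_vector_derivative (\<Sum>n. c' n t *\<^sub>R X n)) (at t)"
    by (rule has_vector_derivative_transform_within_open[OF _ S(1,3)]) (use g in \<open>auto simp: sums_iff\<close>)
qed

text \<open>Iterating the integral inequality gives \<open>\<parallel>w s\<parallel> \<le> M (K s)\<^sup>n / n!\<close> for every \<open>n\<close>.\<close>

lemma linear_ode_zero:
  fixes w :: "real \<Rightarrow> 'b::real_normed_vector"
  assumes w': "\<And>t. t \<ge> 0 \<Longrightarrow> (w has_vector_derivative B (w t)) (at t within {0..})"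
    and B: "\<And>v. norm (B v) \<le> K * norm v" and "K \<ge> 0"
    and w0: "w 0 = 0" and T: "T \<ge> 0"
  shows "w T = 0"
proof -
  have cont: "continuous_on {0..s} w" for s
  proof (rule continuous_on_subset[of "{0..}"])
    show "continuous_on {0..} w"
      by (rule continuous_on_vector_derivative) (use w' in auto)
  qed auto
  have der: "(w has_vector_derivative B (w s)) (at s)" if "s > 0" for s
    using w'[of s] that at_within_interior[of s "{0..}"] by simp
  have "compact (w ` {0..T})"
    by (intro compact_continuous_image cont) auto
  then have "bounded (w ` {0..T})" by (rule compact_imp_bounded)
  then obtain M where M: "\<And>s. s \<in> {0..T} \<Longrightarrow> norm (w s) \<le> M"
    unfolding bounded_iff by blast
  have "norm (w s) \<le> M * (K * s) ^ n / fact n" if "s \<in> {0..T}" for n s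
    using that
  proof (induction n arbitrary: s)
    case (Suc n)
    show ?case
    proof (cases "s = 0")
      case False
      \<comment> \<open>\<phi> is the antiderivative of K times the bound from the induction
        hypothesis, so the mean value inequality advances n by one.\<close>
      define \<phi> where "\<phi> = (\<lambda>s. M * (K * s) ^ Suc n / fact (Suc n))"
      have "(\<phi> has_real_derivative (K * (M * (K * r) ^ n / fact n))) (at r)" for r
        unfolding \<phi>_def
        by (rule derivative_eq_intros refl | simp add: field_simps del: of_nat_Suc)+
      then have \<phi>': "(\<phi> has_vector_derivative (K * (M * (K * r) ^ n / fact n))) (at r)" for r
        by (simp add: has_real_derivative_iff_has_vector_derivative)
      have "norm (w s - w 0) \<le> \<phi> s - \<phi> 0"
      proof (rule differentiable_bound_general)
        show "0 < s" using Suc.prems False by auto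
        show "continuous_on {0..s} \<phi>"
          by (auto simp: \<phi>_def intro!: continuous_intros)
        fix r assume r: "0 < r" "r < s"
        have "norm (B (w r)) \<le> K * norm (w r)" by (rule B)
        also have "\<dots> \<le> K * (M * (K * r) ^ n / fact n)"
          using r Suc.prems \<open>K \<ge> 0\<close> by (intro mult_left_mono Suc.IH) auto
        finally show "norm (B (w r)) \<le> K * (M * (K * r) ^ n / fact n)" .
        show "(\<phi> has_vector_derivative K * (M * (K * r) ^ n / fact n)) (at r)"
          by (rule \<phi>')
      qed (auto intro: cont der)
      then show ?thesis by (simp add: w0 \<phi>_def)
    qed (simp add: w0)
  qed (use M in simp)
  moreover have "(\<lambda>n. M * ((K * T) ^ n / fact n)) \<longlonglongrightarrow> M * 0"
    by (intro tendsto_intros) (use summable_LIMSEQ_zero[OF summable_exp[of "K * T"]] in \<open>simp add: field_simps\<close>)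
  ultimately have "norm (w T) \<le> M * 0"
    using T by (intro LIMSEQ_le_const[of "\<lambda>n. M * ((K * T) ^ n / fact n)"]) auto
  then show ?thesis by simp
qed

text \<open>It serves two purposes: to identify the integral of the operator exponential with the
  Duhamel series, and to give uniqueness of the C_b solution.\<close>

lemma linear_ode_unique:
  fixes v w :: "real \<Rightarrow> 'b::real_normed_vector"
  assumes B: "bounded_linear B"
    and v: "\<And>t. t \<ge> 0 \<Longrightarrow> (v has_vector_derivative B (v t) + h) (at t within {0..})"
    and w: "\<And>t. t \<ge> 0 \<Longrightarrow> (w has_vector_derivative B (w t) + h) (at t within {0..})"
    and "v 0 = w 0" and "t \<ge> 0"
  shows "v t = w t"
proof -
  interpret bounded_linear B by fact
  obtain K where "K \<ge> 0" "\<And>v. norm (B v) \<le> norm v * K" using nonneg_bounded by blast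
  then have K': "\<And>v. norm (B v) \<le> K * norm v" by (simp add: mult.commute)
  have "((\<lambda>t. v t - w t) has_vector_derivative B (v t - w t)) (at t within {0..})" if "t \<ge> 0" for t
    using has_vector_derivative_diff[OF v[OF that] w[OF that]] by (simp add: diff)
  from linear_ode_zero[where w = "\<lambda>t. v t - w t" and B = B, OF this K' \<open>K \<ge> 0\<close> _ \<open>t \<ge> 0\<close>]
  have "v t - w t = 0" using \<open>v 0 = w 0\<close> by simp
  then show ?thesis by simp
qed

section \<open>The operator exponential and its time integral\<close>

lemma
  fixes B :: "'b::banach \<Rightarrow> 'b"
  assumes B: "bounded_linear B"
  shows op_exp_0: "op_exp B 0 v = v"
    and op_exp_has_vector_derivative:
      "((\<lambda>s. op_exp B s v) has_vector_derivative B (op_exp B s v)) (at s)"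
proof -
  interpret bounded_linear B by fact
  obtain K where "K \<ge> 0" and K: "\<And>v. norm (B v) \<le> norm v * K" using nonneg_bounded by blast
  have Bn: "norm ((B ^^ n) v) \<le> K ^ n * norm v" for n
  proof (induction n)
    case (Suc n)
    have "norm ((B ^^ Suc n) v) \<le> norm ((B ^^ n) v) * K" using K by simp
    also have "\<dots> \<le> (K ^ n * norm v) * K" using Suc \<open>K \<ge> 0\<close> by (rule mult_right_mono)
    finally show ?case by (simp add: ac_simps)
  qed simp
  let ?c = "\<lambda>n t. t ^ n / fact n :: real"
  let ?c' = "\<lambda>n t. real n * t ^ (n - 1) / fact n"
  let ?M = "\<lambda>R n. real n * \<bar>R\<bar> ^ (n - 1) / fact n * (K ^ n * norm v)"
  have exp0: "(\<lambda>n. ?c n 0 *\<^sub>R (B ^^ n) v) sums v"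
    using sums_single[of 0 "\<lambda>_. v"] by (rule sums_cong[THEN iffD1, rotated]) (simp add: power_0_left)
  then show "op_exp B 0 v = v" by (simp add: op_exp_def sums_iff)
  have der: "(?c n has_real_derivative ?c' n t) (at t)" for n t
    by (rule derivative_eq_intros refl | simp)+
  have bound: "\<bar>?c' n t\<bar> * norm ((B ^^ n) v) \<le> ?M R n" if "\<bar>t\<bar> < R" for R n t
    using that by (intro mult_mono Bn) (auto simp: abs_mult power_abs intro!: mult_left_mono divide_right_mono power_mono)
  \<comment> \<open>The factor n removes the term at 0, where the exponent n - 1 is a truncated
    difference. After the index shift the majorant is an exponential series.\<close>
  have sM: "summable (?M R)" for R
  proof (subst summable_Suc_iff[symmetric])
    have "?M R (Suc n) = (\<bar>R\<bar> * K) ^ n /\<^sub>R fact n * (K * norm v)" for n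
      by (simp add: field_simps power_mult_distrib del: of_nat_Suc)
    then show "summable (\<lambda>n. ?M R (Suc n))"
      using summable_mult2[OF summable_exp_generic[of "\<bar>R\<bar> * K"]] by simp
  qed
  note main = summable_scaleR_series[where c = ?c and c' = ?c' and M = ?M, OF der bound sM sums_summable[OF exp0]]
    has_vector_derivative_suminf[where c = ?c and c' = ?c' and M = ?M, OF der bound sM sums_summable[OF exp0]]
  have "(\<Sum>n. ?c' n s *\<^sub>R (B ^^ n) v) = (\<Sum>n. ?c' (Suc n) s *\<^sub>R (B ^^ Suc n) v)"
  proof -
    have "summable (\<lambda>n. ?c' n s *\<^sub>R (B ^^ n) v)"
      by (rule summable_comparison_test'[OF sM[of "\<bar>s\<bar> + 1"], of 0]) (use bound[of s "\<bar>s\<bar> + 1"] in auto)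
    then show ?thesis by (subst suminf_split_head) auto
  qed
  also have "\<dots> = (\<Sum>n. B (?c n s *\<^sub>R (B ^^ n) v))"
    by (intro suminf_cong) (simp add: scaleR field_simps del: of_nat_Suc)
  also have "\<dots> = B (op_exp B s v)"
    unfolding op_exp_def by (rule suminf[symmetric]) (rule main)
  finally show "((\<lambda>s. op_exp B s v) has_vector_derivative B (op_exp B s v)) (at s)"
    using main(2)[of s] by (simp add: op_exp_def)
qed

text \<open>Integrating the equation for e^{sB} v over [0,t] and taking B out of the integral gives
  e^{tB} v = B (V t) + v. The left side is also the derivative of V.\<close>

lemma integral_op_exp_has_vector_derivative:
  fixes B :: "'b::banach \<Rightarrow> 'b" and v :: 'b
  assumes B: "bounded_linear B" and t: "t \<ge> 0"
  defines "V \<equiv> \<lambda>t. integral {0..t} (\<lambda>s. op_exp B s v)"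
  shows "(V has_vector_derivative B (V t) + v) (at t within {0..})"
proof -
  note der = op_exp_has_vector_derivative[OF B]
  have cont: "continuous_on S (\<lambda>s. op_exp B s v)" for S
    by (rule continuous_on_vector_derivative) (rule has_vector_derivative_at_within[OF der])
  have int: "(\<lambda>s. op_exp B s v) integrable_on {0..t}"
    by (rule integrable_continuous_real[OF cont])
  have "((\<lambda>s. B (op_exp B s v)) has_integral op_exp B t v - op_exp B 0 v) {0..t}"
    by (rule fundamental_theorem_of_calculus[OF t]) (rule has_vector_derivative_at_within[OF der])
  moreover have "((\<lambda>s. B (op_exp B s v)) has_integral B (V t)) {0..t}"
    using has_integral_linear[OF integrable_integral[OF int] B] by (simp add: o_def V_def)
  ultimately have *: "op_exp B t v = B (V t) + v"
    by (auto simp: op_exp_0[OF B] dest: has_integral_unique)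
  \<comment> \<open>The interval extends beyond t so that near t it coincides with
    \<open>{0..}\<close>; with {0..t} only a left derivative would result.\<close>
  have "(V has_vector_derivative op_exp B t v) (at t within {0..t+1})"
    unfolding V_def by (rule integral_has_vector_derivative[OF cont]) (use t in auto)
  also have "at t within {0..t+1} = at t within {0..}"
    by (rule at_within_nhd[where S = "{..<t+1}"]) auto
  finally show ?thesis by (simp add: *)
qed

text \<open>\<open>duhamel_coeff c k t\<close> is \<open>\<integral>\<^sub>0\<^sup>t e\<^bsup>-cs\<^esup> s\<^sup>k / k! ds\<close>, evaluated by partial integration.\<close>

primrec duhamel_coeff :: "real \<Rightarrow> nat \<Rightarrow> real \<Rightarrow> real" where
  "duhamel_coeff c 0 t = (1 - exp (- c * t)) / c"
| "duhamel_coeff c (Suc k) t = (duhamel_coeff c k t - exp (- c * t) * t ^ Suc k / fact (Suc k)) / c"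

lemma duhamel_coeff_at_0 [simp]: "duhamel_coeff c k 0 = 0"
  by (induction k) auto

lemma duhamel_coeff_deriv:
  assumes "c \<noteq> 0"
  shows "(duhamel_coeff c k has_real_derivative exp (- c * t) * t ^ k / fact k) (at t)"
proof (induction k)
  case 0
  show ?case unfolding duhamel_coeff.simps
    by (rule derivative_eq_intros refl | simp add: assms)+
next
  case (Suc k)
  show ?case unfolding duhamel_coeff.simps
    by (rule derivative_eq_intros refl Suc | simp add: assms field_simps del: of_nat_Suc)+
qed

lemma duhamel_coeff_nonneg:
  assumes "c \<noteq> 0" "t \<ge> 0"
  shows "0 \<le> duhamel_coeff c k t"
  using DERIV_nonneg_imp_nondecreasing[OF assms(2), of "duhamel_coeff c k"] duhamel_coeff_deriv[OF assms(1), of k]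
  by force

text \<open>The bound is the same integral over the whole half-line. The recursion subtracts a
  nonnegative term and divides by c, so the bound passes from k to k + 1.\<close>

lemma duhamel_coeff_le:
  assumes "c > 0" "t \<ge> 0"
  shows "duhamel_coeff c k t \<le> 1 / c ^ Suc k"
proof (induction k)
  case (Suc k)
  have "0 \<le> exp (- c * t) * t ^ Suc k / fact (Suc k)" using assms by simp
  then have "duhamel_coeff c k t - exp (- c * t) * t ^ Suc k / fact (Suc k) \<le> 1 / c ^ Suc k" using Suc by linarith
  then have "duhamel_coeff c (Suc k) t \<le> 1 / c ^ Suc k / c"
    unfolding duhamel_coeff.simps using assms(1) by (intro divide_right_mono) auto
  then show ?case by (simp add: field_simps)
qed (use assms in \<open>simp add: field_simps\<close>)

lemma summable_inverse_power:
  fixes c :: real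
  assumes "c > 1"
  shows "summable (\<lambda>k. 1 / c ^ Suc k)"
  using summable_mult2[OF summable_geometric[of "1 / c"], of "1 / c"] assms by (simp add: power_divide mult.commute)

lemma summable_duhamel_coeff:
  assumes "c > 1" "t \<ge> 0"
  shows "summable (\<lambda>k. duhamel_coeff c k t)"
  by (rule summable_comparison_test'[OF summable_inverse_power[OF assms(1)], of 0])
    (use assms duhamel_coeff_nonneg[of c t] duhamel_coeff_le[of c t] in auto)

text \<open>The k-th term r_k is the integral of e^{-cs} s^k / k! from t to infinity. With e_k =
  e^{-ct} t^k / k! it satisfies c r_0 = e_0 and c r_{k+1} = r_k + e_{k+1}. Summing over k, the total
  S satisfies c S = S + e^{-ct} e^t.\<close>

lemma duhamel_tail_sums:
  assumes "c > 1" "t \<ge> 0"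
  shows "(\<lambda>k. 1 / c ^ Suc k - duhamel_coeff c k t) sums (exp (- (c - 1) * t) / (c - 1))"
proof -
  define r where "r = (\<lambda>k. 1 / c ^ Suc k - duhamel_coeff c k t)"
  define e where "e = (\<lambda>k. exp (- c * t) * (t ^ k / fact k))"
  have r: "summable r"
    unfolding r_def by (intro summable_diff summable_inverse_power summable_duhamel_coeff assms)
  have e: "e sums (exp (- c * t) * exp t)"
    unfolding e_def using exp_converges[of t] by (intro sums_mult) (simp add: field_simps)
  have r0: "c * r 0 = e 0"
    using assms(1) by (simp add: r_def e_def field_simps)
  have rS: "c * r (Suc k) = r k + e (Suc k)" for k
    using assms(1) by (simp add: r_def e_def field_simps del: of_nat_Suc fact_Suc)
  have "c * suminf r = (\<Sum>k. c * r (Suc k)) + c * r 0"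
  proof -
    have "suminf r = (\<Sum>k. r (Suc k)) + r 0"
      using suminf_split_head[OF r] by simp
    then show ?thesis
      using suminf_mult[OF summable_Suc_iff[THEN iffD2, OF r], of c] by (simp add: distrib_left)
  qed
  also have "\<dots> = suminf r + ((\<Sum>k. e (Suc k)) + e 0)"
    using r sums_summable[OF e] by (simp add: rS r0 suminf_add[symmetric] summable_Suc_iff)
  also have "(\<Sum>k. e (Suc k)) + e 0 = exp (- c * t) * exp t"
    using suminf_split_head[OF sums_summable[OF e]] sums_unique[OF e] by simp
  finally have "(c - 1) * suminf r = exp (- (c - 1) * t)"
    by (simp add: algebra_simps flip: exp_add)
  then have "suminf r = exp (- (c - 1) * t) / (c - 1)"
    using assms(1) by (simp add: field_simps)
  with summable_sums[OF r] have "r sums (exp (- (c - 1) * t) / (c - 1))" by simp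
  then show ?thesis by (simp only: r_def)
qed

section \<open>Neumann and Duhamel series of a contraction\<close>

locale contraction = bounded_linear A for A :: "'b::banach \<Rightarrow> 'b" +
  fixes c :: real
  assumes norm_le: "norm (A v) \<le> norm v" and c: "c > 1"
begin

lemma norm_iterate_le: "norm ((A ^^ n) v) \<le> norm v"
proof (induction n)
  case (Suc n)
  then show ?case using norm_le[of "(A ^^ n) v"] by simp
qed simp

lemma summable_scaleR_iterates:
  assumes "summable (\<lambda>k. \<bar>p k\<bar>)"
  shows "summable (\<lambda>k. p k *\<^sub>R (A ^^ k) v)"
  by (rule summable_comparison_test'[OF summable_mult2[OF assms, of "norm v"], of 0])
    (auto intro: mult_left_mono norm_iterate_le)

lemma norm_suminf_iterates_le:
  assumes "p sums s" "\<And>k. 0 \<le> p k"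
  shows "norm (\<Sum>k. p k *\<^sub>R (A ^^ k) v) \<le> s * norm v"
proof -
  have p: "summable p" "suminf p = s" using assms(1) by (auto simp: sums_iff)
  have n: "norm (p k *\<^sub>R (A ^^ k) v) \<le> p k * norm v" for k
    using assms(2) by (auto intro: mult_left_mono norm_iterate_le)
  have "norm (\<Sum>k. p k *\<^sub>R (A ^^ k) v) \<le> (\<Sum>k. p k * norm v)"
    by (intro norm_suminf_le n summable_mult2 p)
  also have "\<dots> = s * norm v" using p by (simp add: suminf_mult2[symmetric])
  finally show ?thesis .
qed

definition duhamel_series :: "'b \<Rightarrow> real \<Rightarrow> 'b" where
  "duhamel_series f t = (\<Sum>k. duhamel_coeff c k t *\<^sub>R (A ^^ k) f)"

definition neumann_series :: "'b \<Rightarrow> 'b" where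
  "neumann_series f = (\<Sum>k. (1 / c ^ Suc k) *\<^sub>R (A ^^ k) f)"

lemma neumann_summable: "summable (\<lambda>k. (1 / c ^ Suc k) *\<^sub>R (A ^^ k) f)"
  by (rule summable_scaleR_iterates) (use summable_inverse_power[OF c] c in simp)

text \<open>A sends the k-th term to c times the term with index k + 1, so A applied to the series
  is c times the series without its first term f / c.\<close>

lemma neumann_series_solves: "c *\<^sub>R neumann_series f - A (neumann_series f) = f"
proof -
  have "A (neumann_series f) = (\<Sum>k. A ((1 / c ^ Suc k) *\<^sub>R (A ^^ k) f))"
    unfolding neumann_series_def by (rule suminf[OF neumann_summable])
  also have "\<dots> = (\<Sum>k. c *\<^sub>R ((1 / c ^ Suc (Suc k)) *\<^sub>R (A ^^ Suc k) f))"
    using c by (intro suminf_cong) (simp add: scaleR)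
  also have "\<dots> = c *\<^sub>R (\<Sum>k. (1 / c ^ Suc (Suc k)) *\<^sub>R (A ^^ Suc k) f)"
    using neumann_summable[of f]
    by (intro suminf_scaleR_right[symmetric]) (simp only: summable_Suc_iff[of "\<lambda>k. (1 / c ^ Suc k) *\<^sub>R (A ^^ k) f"])
  also have "(\<Sum>k. (1 / c ^ Suc (Suc k)) *\<^sub>R (A ^^ Suc k) f) = neumann_series f - (1 / c) *\<^sub>R f"
    using suminf_split_head[OF neumann_summable[of f]] by (simp add: neumann_series_def)
  finally show ?thesis using c by (simp add: scaleR_diff_right)
qed

lemma bij_resolvent: "bij (\<lambda>v. c *\<^sub>R v - A v)"
proof (rule bijI)
  show "surj (\<lambda>v. c *\<^sub>R v - A v)"
    by (rule surjI[of _ neumann_series]) (rule neumann_series_solves)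
  show "inj (\<lambda>v. c *\<^sub>R v - A v)"
  proof (rule injI)
    fix v w assume "c *\<^sub>R v - A v = c *\<^sub>R w - A w"
    then have "c *\<^sub>R (v - w) = A (v - w)" by (simp add: diff algebra_simps)
    then have "norm (c *\<^sub>R (v - w)) \<le> norm (v - w)" by (simp only: norm_le)
    then have "c * norm (v - w) \<le> norm (v - w)" using c by simp
    then have "(c - 1) * norm (v - w) \<le> 0" by (simp add: algebra_simps)
    then show "v = w" using c by (simp add: mult_le_0_iff)
  qed
qed

lemma inv_resolvent: "inv (\<lambda>v. c *\<^sub>R v - A v) f = neumann_series f"
  using inv_f_f[OF bij_is_inj[OF bij_resolvent], of "neumann_series f"] by (simp add: neumann_series_solves)

lemma bounded_linear_generator: "bounded_linear (\<lambda>v. A v - c *\<^sub>R v)"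
  by (intro bounded_linear_sub bounded_linear_scaleR_right bounded_linear_axioms)

text \<open>Write p_k for the coefficients. Their recursion reads c p_0 = 1 - p_0' and c p_{k+1} =
  p_k - p_{k+1}'. Summing it against A^k f expresses the termwise derivative as the right side of
  the equation.\<close>

lemma duhamel_series_has_vector_derivative:
  assumes "t \<ge> 0"
  shows "(duhamel_series f has_vector_derivative (A (duhamel_series f t) - c *\<^sub>R duhamel_series f t) + f) (at t)"
proof -
  let ?p = "duhamel_coeff c" and ?p' = "\<lambda>k t. exp (- c * t) * t ^ k / fact k"
  let ?X = "\<lambda>k. (A ^^ k) f"
  let ?M = "\<lambda>R k. exp (c * \<bar>R\<bar>) * (\<bar>R\<bar> ^ k / fact k) * norm f"
  have c0: "c \<noteq> 0" using c by simp
  \<comment> \<open>The symmetric interval includes negative times, where e^{-ct} exceeds 1; this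
    accounts for the factor e^{c |R|} in the majorant.\<close>
  have bound: "\<bar>?p' k t\<bar> * norm (?X k) \<le> ?M R k" if "\<bar>t\<bar> < R" for k t R
  proof -
    have "c * -t \<le> c * \<bar>R\<bar>" using that c by (intro mult_left_mono) auto
    then have "\<bar>?p' k t\<bar> \<le> exp (c * \<bar>R\<bar>) * \<bar>R\<bar> ^ k / fact k"
      using that by (auto simp: abs_mult power_abs intro!: divide_right_mono mult_mono power_mono)
    then show ?thesis
      using mult_mono[OF _ norm_iterate_le[of k f], of "\<bar>?p' k t\<bar>" "exp (c * \<bar>R\<bar>) * \<bar>R\<bar> ^ k / fact k"] by simp
  qed
  have sM: "summable (?M R)" for R
    using summable_exp_generic[of "\<bar>R\<bar>"] by (intro summable_mult summable_mult2) (simp add: field_simps)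
  have s0: "summable (\<lambda>k. ?p k 0 *\<^sub>R ?X k)" by simp
  have der: "(duhamel_series f has_vector_derivative (\<Sum>k. ?p' k t *\<^sub>R ?X k)) (at t)"
    unfolding duhamel_series_def[abs_def]
    by (rule has_vector_derivative_suminf[OF duhamel_coeff_deriv[OF c0] bound sM s0])
  have S: "summable (\<lambda>k. ?p k t *\<^sub>R ?X k)"
    by (rule summable_scaleR_series[OF duhamel_coeff_deriv[OF c0] bound sM s0])
  have S': "summable (\<lambda>k. ?p' k t *\<^sub>R ?X k)"
    by (rule summable_comparison_test'[OF sM[of "\<bar>t\<bar> + 1"], of 0]) (use bound[of t "\<bar>t\<bar> + 1"] in auto)
  have "c *\<^sub>R duhamel_series f t = (\<Sum>k. c *\<^sub>R ?p (Suc k) t *\<^sub>R ?X (Suc k)) + c *\<^sub>R ?p 0 t *\<^sub>R f"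
  proof -
    have "summable (\<lambda>k. ?p (Suc k) t *\<^sub>R ?X (Suc k))" using S by (rule summable_Suc_iff[THEN iffD2])
    then have "(\<Sum>k. c *\<^sub>R ?p (Suc k) t *\<^sub>R ?X (Suc k)) = c *\<^sub>R (\<Sum>k. ?p (Suc k) t *\<^sub>R ?X (Suc k))"
      by (rule suminf_scaleR_right[symmetric])
    also have "(\<Sum>k. ?p (Suc k) t *\<^sub>R ?X (Suc k)) = duhamel_series f t - ?p 0 t *\<^sub>R f"
      unfolding duhamel_series_def suminf_split_head[OF S] by (simp only: funpow_0)
    finally show ?thesis by (simp only: scaleR_diff_right diff_add_cancel)
  qed
  also have "(\<Sum>k. c *\<^sub>R ?p (Suc k) t *\<^sub>R ?X (Suc k)) = (\<Sum>k. ?p k t *\<^sub>R A (?X k) - ?p' (Suc k) t *\<^sub>R ?X (Suc k))"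
    using c by (intro suminf_cong) (simp add: scaleR_diff_left[symmetric] del: fact_Suc power_Suc)
  also have "\<dots> = A (duhamel_series f t) - (\<Sum>k. ?p' (Suc k) t *\<^sub>R ?X (Suc k))"
    using suminf_diff[OF summable[OF S, unfolded scaleR] summable_Suc_iff[THEN iffD2, OF S']]
    unfolding duhamel_series_def suminf[OF S] scaleR by (simp del: fact_Suc power_Suc)
  also have "(\<Sum>k. ?p' (Suc k) t *\<^sub>R ?X (Suc k)) = (\<Sum>k. ?p' k t *\<^sub>R ?X k) - exp (- c * t) *\<^sub>R f"
    using suminf_split_head[OF S'] by simp
  also have "c *\<^sub>R ?p 0 t *\<^sub>R f = f - exp (- c * t) *\<^sub>R f"
    using c by (simp add: scaleR_diff_left)
  finally have "(\<Sum>k. ?p' k t *\<^sub>R ?X k) = (A (duhamel_series f t) - c *\<^sub>R duhamel_series f t) + f"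
    by (simp add: algebra_simps)
  with der show ?thesis by simp
qed

lemma duhamel_series_0: "duhamel_series f 0 = 0"
  by (simp add: duhamel_series_def)

text \<open>Both sides solve the same inhomogeneous equation and vanish at time 0, so uniqueness
  identifies them; the exponential of A - c need not be multiplied out. The right side is the form
  in which positivity is visible.\<close>

lemma integral_op_exp_eq_duhamel_series:
  assumes "t \<ge> 0"
  shows "integral {0..t} (\<lambda>s. op_exp (\<lambda>v. A v - c *\<^sub>R v) s f) = duhamel_series f t"
  by (rule linear_ode_unique[OF bounded_linear_generator _ _ _ assms])
    (auto intro: integral_op_exp_has_vector_derivative[OF bounded_linear_generator] duhamel_series_0
      has_vector_derivative_at_within[OF duhamel_series_has_vector_derivative])

lemma norm_duhamel_neumann:
  assumes "t \<ge> 0"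
  shows "norm (duhamel_series f t - neumann_series f) \<le> exp (- (c - 1) * t) / (c - 1) * norm f"
proof -
  have c0: "c \<noteq> 0" "c > 0" using c by auto
  have "neumann_series f - duhamel_series f t = (\<Sum>k. (1 / c ^ Suc k - duhamel_coeff c k t) *\<^sub>R (A ^^ k) f)"
    unfolding neumann_series_def duhamel_series_def scaleR_diff_left
    using summable_duhamel_coeff[OF c assms] duhamel_coeff_nonneg[OF c0(1) assms]
    by (intro suminf_diff neumann_summable summable_scaleR_iterates) auto
  also have "norm \<dots> \<le> exp (- (c - 1) * t) / (c - 1) * norm f"
    by (rule norm_suminf_iterates_le[OF duhamel_tail_sums[OF c assms]]) (use duhamel_coeff_le[OF c0(2) assms] in simp)
  finally show ?thesis by (simp add: norm_minus_commute)
qed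

end

section \<open>Square-integrable functions\<close>

lemma square_integrableD:
  assumes "square_integrable v"
  shows "v \<in> borel_measurable borel" "integrable lborel (\<lambda>x. (v x)\<^sup>2)"
  using assms by (auto simp: square_integrable_def)

lemma integrable_mult_square_integrable:
  fixes v w :: "'a::euclidean_space \<Rightarrow> real"
  assumes "square_integrable v" "square_integrable w"
  shows "integrable lborel (\<lambda>x. v x * w x)"
proof (rule Bochner_Integration.integrable_bound)
  show "integrable lborel (\<lambda>x. (v x)\<^sup>2 + (w x)\<^sup>2)"
    using assms by (intro Bochner_Integration.integrable_add square_integrableD)
  have "\<bar>v x * w x\<bar> \<le> (v x)\<^sup>2 + (w x)\<^sup>2" for x
    using sum_squares_bound[of "\<bar>v x\<bar>" "\<bar>w x\<bar>"] abs_ge_zero[of "v x * w x"]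
    unfolding power2_abs abs_mult by linarith
  then show "AE x in lborel. norm (v x * w x) \<le> norm ((v x)\<^sup>2 + (w x)\<^sup>2)"
    by auto
qed (use assms[THEN square_integrableD(1)] in auto)

lemma square_integrable_scale:
  "square_integrable v \<Longrightarrow> square_integrable (\<lambda>x. k * v x)"
  by (auto simp: square_integrable_def power_mult_distrib)

lemma square_integrable_add:
  assumes "square_integrable v" "square_integrable w"
  shows "square_integrable (\<lambda>x. v x + w x)"
proof -
  have "integrable lborel (\<lambda>x. (v x)\<^sup>2 + 2 * (v x * w x) + (w x)\<^sup>2)"
    using assms by (intro Bochner_Integration.integrable_add square_integrableD integrable_mult_right
        integrable_mult_square_integrable)
  also have "(\<lambda>x. (v x)\<^sup>2 + 2 * (v x * w x) + (w x)\<^sup>2) = (\<lambda>x. (v x + w x)\<^sup>2)"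
    by (auto simp: power2_eq_square algebra_simps)
  finally show ?thesis
    using assms by (auto simp: square_integrable_def)
qed

lemma square_integrable_diff:
  assumes "square_integrable v" "square_integrable w"
  shows "square_integrable (\<lambda>x. v x - w x)"
  using square_integrable_add[OF assms(1) square_integrable_scale[OF assms(2), of "-1"]] by simp

lemma integral_square_diff:
  assumes "square_integrable v" "square_integrable w"
  shows "(LINT x|lborel. (v x - k * w x)\<^sup>2)
    = (LINT x|lborel. (v x)\<^sup>2) - 2 * k * (LINT x|lborel. v x * w x) + k\<^sup>2 * (LINT x|lborel. (w x)\<^sup>2)"
proof -
  have "(\<lambda>x. (v x - k * w x)\<^sup>2) = (\<lambda>x. (v x)\<^sup>2 - (2 * k) * (v x * w x) + k\<^sup>2 * (w x)\<^sup>2)"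
    by (auto simp: power2_eq_square algebra_simps)
  then show ?thesis
    using assms[THEN square_integrableD(2)] integrable_mult_square_integrable[OF assms] by simp
qed

lemma Cauchy_Schwarz_L2:
  assumes "square_integrable v" "square_integrable w"
  shows "\<bar>LINT x|lborel. v x * w x\<bar> \<le> sqrt (LINT x|lborel. (v x)\<^sup>2) * sqrt (LINT x|lborel. (w x)\<^sup>2)"
proof -
  define p q r where "p = (LINT x|lborel. (v x)\<^sup>2)" and "q = (LINT x|lborel. v x * w x)"
    and "r = (LINT x|lborel. (w x)\<^sup>2)"
  have quad: "0 \<le> p - 2 * k * q + k\<^sup>2 * r" for k
    unfolding p_def q_def r_def integral_square_diff[OF assms, symmetric]
    by (rule integral_nonneg_AE) auto
  have "r \<ge> 0" unfolding r_def by (rule integral_nonneg_AE) auto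
  have "q\<^sup>2 \<le> p * r"
  proof (cases "r = 0")
    case True
    have "q = 0"
    proof (rule ccontr)
      assume "q \<noteq> 0"
      \<comment> \<open>With r = 0 the expression is affine in k, and this k makes it equal to
        -1.\<close>
      then show False using quad[of "(p + 1) / (2 * q)"] True by simp
    qed
    then show ?thesis using True by simp
  next
    case False
    \<comment> \<open>k = q / r minimises the quadratic, and its nonnegativity there is the
      inequality.\<close>
    then show ?thesis
      using quad[of "q / r"] \<open>r \<ge> 0\<close> by (simp add: field_simps power2_eq_square)
  qed
  then have "\<bar>q\<bar> \<le> sqrt (p * r)" by (simp add: real_le_rsqrt)
  then show ?thesis by (simp add: p_def q_def r_def real_sqrt_mult)
qed

lemma integral_square_add_le:
  assumes "square_integrable v" "square_integrable w"
  shows "(LINT x|lborel. (v x + w x)\<^sup>2) \<le> 2 * (LINT x|lborel. (v x)\<^sup>2) + 2 * (LINT x|lborel. (w x)\<^sup>2)"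
proof -
  have "(LINT x|lborel. (v x + w x)\<^sup>2) \<le> (LINT x|lborel. 2 * (v x)\<^sup>2 + 2 * (w x)\<^sup>2)"
  proof (rule integral_mono)
    show "(v x + w x)\<^sup>2 \<le> 2 * (v x)\<^sup>2 + 2 * (w x)\<^sup>2" for x
      using zero_le_power2[of "v x - w x"] by (simp add: power2_eq_square algebra_simps)
  qed (auto intro!: square_integrableD square_integrable_add assms)
  then show ?thesis
    using assms[THEN square_integrableD(2)] by simp
qed

lemma integral_square_zero_AE:
  assumes "square_integrable v" "(LINT x|lborel. (v x)\<^sup>2) \<le> 0"
  shows "AE x in lborel. v x = 0"
proof -
  have "(LINT x|lborel. (v x)\<^sup>2) = 0"
    using assms(2) by (intro antisym integral_nonneg_AE) auto
  then show ?thesis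
    using square_integrableD(2)[OF assms(1)] by (subst (asm) integral_nonneg_eq_0_iff_AE) auto
qed

lemma square_integrable_bcontfun:
  fixes v :: "'a::euclidean_space \<Rightarrow>\<^sub>C real"
  assumes "integrable lborel (apply_bcontfun v)"
  shows "square_integrable (apply_bcontfun v)"
    and "(LINT x|lborel. (apply_bcontfun v x)\<^sup>2) \<le> norm v * (LINT x|lborel. \<bar>apply_bcontfun v x\<bar>)"
proof -
  have [measurable]: "apply_bcontfun v \<in> borel_measurable borel"
    by (rule borel_measurable_continuous_onI) simp
  have bd: "\<bar>apply_bcontfun v x\<bar> \<le> norm v" for x
    using norm_bounded[of v x] by simp
  have i: "integrable lborel (\<lambda>x. (apply_bcontfun v x)\<^sup>2)"
    using integrable_mult_bounded[OF assms _ bd] by (simp add: power2_eq_square)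
  then show "square_integrable (apply_bcontfun v)" by (simp add: square_integrable_def)
  have "(LINT x|lborel. (apply_bcontfun v x)\<^sup>2) \<le> (LINT x|lborel. norm v * \<bar>apply_bcontfun v x\<bar>)"
  proof (rule integral_mono[OF i])
    show "(apply_bcontfun v x)\<^sup>2 \<le> norm v * \<bar>apply_bcontfun v x\<bar>" for x
      using mult_right_mono[OF bd[of x], of "\<bar>apply_bcontfun v x\<bar>"] by (simp add: power2_eq_square abs_mult_self_eq)
  qed (use assms in auto)
  then show "(LINT x|lborel. (apply_bcontfun v x)\<^sup>2) \<le> norm v * (LINT x|lborel. \<bar>apply_bcontfun v x\<bar>)"
    by simp
qed

lemma bounded_linear_apply_bcontfun: "bounded_linear (\<lambda>v::'a::topological_space \<Rightarrow>\<^sub>C 'b::real_normed_vector. apply_bcontfun v x)"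
  by (rule bounded_linear_intro[where K = 1]) (use norm_bounded in auto)

section \<open>Convolution on C_b and energy decay in L^2\<close>

context kernel
begin

lemma conv_diff:
  assumes "integrable lborel (\<lambda>y. a (x - y) * v y)" "integrable lborel (\<lambda>y. a (x - y) * w y)"
  shows "conv a (\<lambda>y. v y - w y) x = conv a v x - conv a w x"
  using assms by (simp add: conv_def right_diff_distrib)

text \<open>Defining the operator through \<open>L0_Cb\<close> lets it inherit continuity and
  boundedness of the image from \<open>L0_in_bcontfun\<close>; that it is convolution with
  \<open>a\<close> is then \<open>apply_conv_Cb\<close>.\<close>

definition conv_Cb :: "('a \<Rightarrow>\<^sub>C real) \<Rightarrow> ('a \<Rightarrow>\<^sub>C real)" where
  "conv_Cb v = L0_Cb a v + v"

lemma borel_apply [measurable]: "apply_bcontfun (v :: 'a \<Rightarrow>\<^sub>C real) \<in> borel_measurable borel"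
  by (rule borel_measurable_continuous_onI) simp

lemma integrable_conv_integrand_Cb: "integrable lborel (\<lambda>y. a (x - y) * apply_bcontfun v y)"
  by (rule integrable_conv_integrand_bounded[of _ "norm v"]) (use norm_bounded[of v] in auto)

lemma apply_L0_Cb: "apply_bcontfun (L0_Cb a v) x = conv a (apply_bcontfun v) x - apply_bcontfun v x"
proof -
  have "L0 a (apply_bcontfun v) \<in> bcontfun"
    by (rule L0_in_bcontfun[OF int apply_bcontfun])
  then show ?thesis
    by (simp add: L0_Cb_def Bcontfun_inverse L0_eq_conv integrable_conv_integrand_Cb)
qed

lemma apply_conv_Cb: "apply_bcontfun (conv_Cb v) x = conv a (apply_bcontfun v) x"
  by (simp add: conv_Cb_def apply_L0_Cb)

lemma norm_conv_Cb: "norm (conv_Cb v) \<le> norm v"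
  by (rule norm_bound) (use norm_bounded[of v] in \<open>auto simp: apply_conv_Cb intro!: conv_bound\<close>)

lemma bounded_linear_conv_Cb: "bounded_linear conv_Cb"
proof (rule bounded_linear_intro[where K = 1])
  show "conv_Cb (v + w) = conv_Cb v + conv_Cb w" for v w
    using integrable_conv_integrand_Cb
    by (intro bcontfun_eqI) (simp add: apply_conv_Cb conv_def distrib_left)
  show "conv_Cb (r *\<^sub>R v) = r *\<^sub>R conv_Cb v" for r v
    by (intro bcontfun_eqI) (simp add: apply_conv_Cb conv_def mult.left_commute)
qed (use norm_conv_Cb in simp)

text \<open>The derivative of \<open>\<parallel>w\<parallel>\<^sup>2\<close> is \<open>2 \<langle>w, a * w - c w\<rangle> \<le> 0\<close>.\<close>

lemma conv_evolution_L2_zero: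
  assumes w: "\<And>t. t \<ge> 0 \<Longrightarrow> square_integrable (w t)"
    and w0: "AE x in lborel. w 0 x = 0"
    and der: "\<And>t. t \<ge> 0 \<Longrightarrow>
      ((\<lambda>s. LINT x|lborel. ((w s x - w t x) / (s - t) - (conv a (w t) x - c * w t x))\<^sup>2) \<longlongrightarrow> 0) (at t within {0..})"
    and c: "c \<ge> 1" and T: "T \<ge> 0"
  shows "AE x in lborel. w T x = 0"
proof -
  define \<phi> where "\<phi> = (\<lambda>t. LINT x|lborel. (w t x)\<^sup>2)"
  define B where "B = (\<lambda>t x. conv a (w t) x - c * w t x)"
  define e where "e = (\<lambda>t s x. (w s x - w t x) / (s - t) - B t x)"
  define D where "D = (\<lambda>t. 2 * (LINT x|lborel. B t x * w t x))"
  have B: "square_integrable (B t)" if "t \<ge> 0" for t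
    unfolding B_def by (intro square_integrable_diff square_integrable_conv square_integrable_scale w that)
  have e: "square_integrable (e t s)" if "t \<ge> 0" "s \<ge> 0" for t s
    unfolding e_def using square_integrable_scale[OF square_integrable_diff[OF w[OF that(2)] w[OF that(1)]], of "1 / (s - t)"]
    by (intro square_integrable_diff B that) simp
  have \<phi>': "(\<phi> has_real_derivative D t) (at t within {0..})" if t: "t \<ge> 0" for t
  proof -
    define \<epsilon> where "\<epsilon> = (\<lambda>s. LINT x|lborel. (e t s x)\<^sup>2)"
    define \<beta> where "\<beta> = (LINT x|lborel. (B t x)\<^sup>2)"
    have \<epsilon>: "(\<epsilon> \<longlongrightarrow> 0) (at t within {0..})"
      using der[OF t] by (simp add: \<epsilon>_def e_def B_def)
    have main: "\<bar>(\<phi> s - \<phi> t) / (s - t) - D t\<bar> \<le> 2 * (sqrt (\<epsilon> s) * sqrt (\<phi> t)) + \<bar>s - t\<bar> * (2 * \<epsilon> s + 2 * \<beta>)"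
      if s: "s \<ge> 0" "s \<noteq> t" for s
    proof -
      \<comment> \<open>For s different from t, d is the difference quotient itself. Expanding the
        square of w s = w t + (s - t) d leaves twice the pairing of w t with d, plus (s - t) times
        the square norm of d; the part e of d enters only as an error.\<close>
      define d where "d = (\<lambda>x. e t s x + B t x)"
      have d: "square_integrable d"
        unfolding d_def by (intro square_integrable_add e B t s)
      have "w s x = w t x - (t - s) * d x" for x
        using s(2) by (simp add: d_def e_def field_simps)
      then have "\<phi> s = (LINT x|lborel. (w t x - (t - s) * d x)\<^sup>2)"
        by (simp add: \<phi>_def)
      also have "\<dots> = \<phi> t - 2 * (t - s) * (LINT x|lborel. w t x * d x) + (t - s)\<^sup>2 * (LINT x|lborel. (d x)\<^sup>2)"
        by (simp add: integral_square_diff w t d \<phi>_def)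
      finally have "(\<phi> s - \<phi> t) / (s - t) = 2 * (LINT x|lborel. w t x * d x) + (s - t) * (LINT x|lborel. (d x)\<^sup>2)"
        using s(2) by (simp add: field_simps power2_eq_square)
      also have "(LINT x|lborel. w t x * d x) = (LINT x|lborel. e t s x * w t x) + (LINT x|lborel. B t x * w t x)"
        using integrable_mult_square_integrable[OF e[OF t s(1)] w[OF t]] integrable_mult_square_integrable[OF B[OF t] w[OF t]]
        by (simp add: d_def algebra_simps)
      finally have "(\<phi> s - \<phi> t) / (s - t) - D t = 2 * (LINT x|lborel. e t s x * w t x) + (s - t) * (LINT x|lborel. (d x)\<^sup>2)"
        by (simp add: D_def)
      moreover have "\<bar>LINT x|lborel. e t s x * w t x\<bar> \<le> sqrt (\<epsilon> s) * sqrt (\<phi> t)"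
        unfolding \<epsilon>_def \<phi>_def by (rule Cauchy_Schwarz_L2[OF e[OF t s(1)] w[OF t]])
      moreover have "\<bar>(s - t) * (LINT x|lborel. (d x)\<^sup>2)\<bar> \<le> \<bar>s - t\<bar> * (2 * \<epsilon> s + 2 * \<beta>)"
        unfolding abs_mult using integral_square_add_le[OF e[OF t s(1)] B[OF t]]
        by (intro mult_left_mono) (auto simp: d_def \<epsilon>_def \<beta>_def)
      ultimately show ?thesis by linarith
    qed
    have "((\<lambda>s. 2 * (sqrt (\<epsilon> s) * sqrt (\<phi> t)) + \<bar>s - t\<bar> * (2 * \<epsilon> s + 2 * \<beta>)) \<longlongrightarrow>
        2 * (sqrt 0 * sqrt (\<phi> t)) + \<bar>t - t\<bar> * (2 * 0 + 2 * \<beta>)) (at t within {0..})"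
      by (intro tendsto_intros \<epsilon>)
    then have lim: "((\<lambda>s. 2 * (sqrt (\<epsilon> s) * sqrt (\<phi> t)) + \<bar>s - t\<bar> * (2 * \<epsilon> s + 2 * \<beta>)) \<longlongrightarrow> 0) (at t within {0..})"
      by simp
    have "((\<lambda>s. (\<phi> s - \<phi> t) / (s - t) - D t) \<longlongrightarrow> 0) (at t within {0..})"
      by (rule Lim_null_comparison[OF _ lim]) (use main in \<open>auto simp: eventually_at intro!: exI[of _ 1]\<close>)
    then show ?thesis
      by (simp add: has_field_derivative_iff Lim_null[symmetric])
  qed
  \<comment> \<open>Cauchy-Schwarz and the L^2 contraction bound the pairing of a * w with w by
    \<open>\<phi> t\<close>, which c >= 1 absorbs.\<close>
  have D: "D t \<le> 0" if "t \<ge> 0" for t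
  proof -
    note sq = w[OF that] square_integrable_conv[OF w[OF that]]
    have "(LINT x|lborel. B t x * w t x) = (LINT x|lborel. conv a (w t) x * w t x) - c * \<phi> t"
      using integrable_mult_square_integrable[OF sq(2,1)] square_integrableD(2)[OF sq(1)]
      by (simp add: B_def \<phi>_def left_diff_distrib power2_eq_square mult.assoc)
    also have "(LINT x|lborel. conv a (w t) x * w t x) \<le> sqrt (LINT x|lborel. (conv a (w t) x)\<^sup>2) * sqrt (\<phi> t)"
      using Cauchy_Schwarz_L2[OF sq(2,1)] by (simp add: \<phi>_def)
    also have "\<dots> \<le> sqrt (\<phi> t) * sqrt (\<phi> t)"
      using integral_conv_square_le[OF sq(1)] by (intro mult_right_mono) (auto simp: \<phi>_def)
    also have "\<dots> = \<phi> t" by (simp add: \<phi>_def)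
    finally have "D t \<le> 2 * (\<phi> t - c * \<phi> t)" by (simp add: D_def)
    also have "\<dots> \<le> 0" using mult_right_mono[OF c, of "\<phi> t"] by (simp add: \<phi>_def)
    finally show ?thesis .
  qed
  have "\<phi> T \<le> \<phi> 0"
  proof (rule DERIV_nonpos_imp_decreasing_open[OF T])
    have "continuous_on {0..} \<phi>"
      by (rule DERIV_continuous_on) (use \<phi>' in auto)
    then show "continuous_on {0..T} \<phi>" by (rule continuous_on_subset) auto
    show "\<exists>y. DERIV \<phi> x :> y \<and> y \<le> 0" if "0 < x" "x < T" for x
      using \<phi>'[of x] D[of x] that at_within_interior[of x "{0..}"] by auto
  qed
  also have "\<phi> 0 = 0"
    unfolding \<phi>_def by (rule integral_eq_zero_AE) (use w0 in auto)
  finally show ?thesis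
    using integral_square_zero_AE[OF w[OF T]] by (simp add: \<phi>_def)
qed

end

section \<open>Weights with small growth under convolution\<close>

lemma nn_integral_exp_abs_finite:
  fixes k :: real
  assumes "k > 0"
  shows "(\<integral>\<^sup>+t. ennreal (exp (- k * \<bar>t\<bar>)) \<partial>lborel) < \<infinity>"
proof -
  define h where "h = (\<lambda>t::real. if t \<in> {0..} then exp (- k * t) else 0)"
  have [measurable]: "h \<in> borel_measurable borel" unfolding h_def by measurable
  have "(h has_integral (exp (- k * 0) / k)) UNIV"
    unfolding h_def has_integral_restrict_UNIV by (rule has_integral_exp_minus_to_infinity[OF assms])
  then have "(\<integral>\<^sup>+t. h t \<partial>lborel) = ennreal (exp (- k * 0) / k)"
    by (intro nn_integral_has_integral_lborel) (auto simp: h_def)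
  moreover have "(\<integral>\<^sup>+t. h (0 - t) \<partial>lborel) = (\<integral>\<^sup>+t. h t \<partial>lborel)"
    by (rule nn_integral_reflect) measurable
  moreover have "(\<integral>\<^sup>+t. ennreal (exp (- k * \<bar>t\<bar>)) \<partial>lborel) \<le> (\<integral>\<^sup>+t. ennreal (h t) + ennreal (h (0 - t)) \<partial>lborel)"
    by (intro nn_integral_mono) (auto simp: h_def)
  moreover have "(\<integral>\<^sup>+t. ennreal (h t) + ennreal (h (0 - t)) \<partial>lborel) = (\<integral>\<^sup>+t. h t \<partial>lborel) + (\<integral>\<^sup>+t. h (0 - t) \<partial>lborel)"
    by (rule nn_integral_add) measurable
  ultimately show ?thesis by (auto simp: order_le_less_trans)
qed

text \<open>Each coordinate is at most |x| in absolute value, so with the rate \<epsilon> / d in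
  every coordinate the product of one-dimensional exponentials dominates, and its integral
  factors.\<close>

lemma integrable_exp_norm:
  assumes "\<epsilon> > 0"
  shows "integrable lborel (\<lambda>x::'a::euclidean_space. exp (- \<epsilon> * norm x))"
proof (rule integrableI_bounded)
  define k where "k = \<epsilon> / DIM('a)"
  have k: "k > 0" using assms by (simp add: k_def)
  have le: "exp (- \<epsilon> * norm x) \<le> (\<Prod>b\<in>Basis. exp (- k * \<bar>x \<bullet> b\<bar>))" for x :: 'a
  proof -
    have "(\<Sum>b\<in>Basis. k * \<bar>x \<bullet> b\<bar>) \<le> (\<Sum>b\<in>(Basis::'a set). k * norm x)"
      using k by (intro sum_mono mult_left_mono Basis_le_norm) auto
    also have "\<dots> = \<epsilon> * norm x" by (simp add: k_def)
    finally have "- \<epsilon> * norm x \<le> (\<Sum>b\<in>Basis. - k * \<bar>x \<bullet> b\<bar>)" by (simp add: sum_negf)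
    then show ?thesis by (simp only: exp_sum[symmetric] finite_Basis exp_le_cancel_iff)
  qed
  have "(\<integral>\<^sup>+x. norm (exp (- \<epsilon> * norm (x::'a))) \<partial>lborel) \<le> (\<integral>\<^sup>+x. (\<Prod>b\<in>(Basis::'a set). ennreal (exp (- k * \<bar>x \<bullet> b\<bar>))) \<partial>lborel)"
    using le by (intro nn_integral_mono) (simp add: prod_ennreal ennreal_leI)
  also have "\<dots> = (\<Prod>b\<in>(Basis::'a set). \<integral>\<^sup>+t. ennreal (exp (- k * \<bar>t\<bar>)) \<partial>lborel)"
    by (rule nn_integral_lborel_prod[of "\<lambda>_ t. ennreal (exp (- k * \<bar>t\<bar>))"]) auto
  also have "\<dots> < \<infinity>"
    using nn_integral_exp_abs_finite[OF k] by (simp add: ennreal_prod_eq_top power_less_top_ennreal less_top)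
  finally show "(\<integral>\<^sup>+x. norm (exp (- \<epsilon> * norm (x::'a))) \<partial>lborel) < \<infinity>" .
qed measurable

context kernel
begin

text \<open>The truncation \<open>min l \<omega>\<close> of a power weight \<open>\<omega>\<close> is an almost-supersolution: where \<open>\<bar>x - y\<bar> \<le> \<eta> \<bar>x\<bar>\<close>, the
  weight at \<open>y\<close> is at most \<open>(1 - \<eta>)\<^bsup>-p\<^esup> \<omega> x\<close>; elsewhere \<open>a (x - y)\<close> is at most a multiple of \<open>\<omega> x\<close>,
  and the mass of \<open>min l \<omega>\<close> tends to 0 as \<open>l \<rightarrow> 0\<close>.\<close>

lemma power_weight_supersolution:
  fixes p q :: real
  assumes p: "0 < p" "p \<le> q" and a_le: "\<And>x. a x \<le> bp * (1 + norm x) powr (- q)"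
    and \<omega>_int: "integrable lborel (\<lambda>x::'a. (1 + norm x) powr (- p))"
    and \<kappa>: "\<kappa> > 1"
  obtains l where "0 < l" "l \<le> 1"
    "\<And>x. conv a (\<lambda>y. min l ((1 + norm y) powr (- p))) x \<le> \<kappa> * min l ((1 + norm x) powr (- p))"
proof -
  define \<omega> where "\<omega> = (\<lambda>x::'a. (1 + norm x) powr (- p))"
  have [measurable]: "\<omega> \<in> borel_measurable borel" unfolding \<omega>_def by measurable
  have \<omega>_pos: "0 < \<omega> x" for x
    using norm_ge_zero[of x] by (simp add: \<omega>_def add_nonneg_eq_0_iff)
  have \<omega>_int: "integrable lborel \<omega>" using \<omega>_int by (simp add: \<omega>_def)
  have bp: "bp \<ge> 0"
  proof -
    have "0 \<le> bp * (1 + norm (0::'a)) powr (- q)" using a_le[of 0] nonneg[of 0] by linarith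
    then show ?thesis by simp
  qed
  \<comment> \<open>The excess \<kappa> - 1 is divided equally: the near region may use the factor
    (1 + \<kappa>) / 2, and the far region gets the remaining (\<kappa> - 1) / 2.\<close>
  have "((\<lambda>\<eta>. (1 - \<eta>) powr (- p)) \<longlongrightarrow> (1 - 0) powr (- p)) (at_right (0::real))"
    by (intro tendsto_intros) auto
  then have "\<forall>\<^sub>F \<eta> in at_right 0. (1 - \<eta>) powr (- p) < (1 + \<kappa>) / 2"
    by (rule order_tendstoD) (use \<kappa> in simp)
  moreover have "\<forall>\<^sub>F \<eta>::real in at_right 0. 0 < \<eta> \<and> \<eta> < 1"
    using eventually_at_right_real[of 0 1] by simp
  ultimately have "\<forall>\<^sub>F \<eta> in at_right 0. 0 < \<eta> \<and> \<eta> < 1 \<and> (1 - \<eta>) powr (- p) < (1 + \<kappa>) / 2"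
    by eventually_elim auto
  then obtain \<eta> where \<eta>: "0 < \<eta>" "\<eta> < 1" "(1 - \<eta>) powr (- p) < (1 + \<kappa>) / 2"
    using eventually_happens'[of "at_right (0::real)"] by (auto simp: trivial_limit_at_right_real)
  \<comment> \<open>C depends on \<eta> but not on the level l, so l can be chosen afterwards to
    make C times the mass of the capped weight small.\<close>
  define C where "C = bp * \<eta> powr (- q)"
  have "C \<ge> 0" using bp by (simp add: C_def)
  have far: "a (x - y) \<le> C * \<omega> x" if "norm (x - y) \<ge> \<eta> * norm x" for x y
  proof -
    have "\<eta> * (1 + norm x) \<le> 1 + norm (x - y)" using that \<eta> by (simp add: distrib_left)
    then have "(1 + norm (x - y)) powr (- q) \<le> (\<eta> * (1 + norm x)) powr (- q)"
      using p \<eta> by (intro powr_mono2') (auto intro!: mult_pos_pos add_pos_nonneg)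
    also have "\<dots> \<le> \<eta> powr (- q) * \<omega> x"
      unfolding powr_mult \<omega>_def using p by (intro mult_left_mono powr_mono) auto
    finally have "bp * (1 + norm (x - y)) powr (- q) \<le> bp * (\<eta> powr (- q) * \<omega> x)"
      by (rule mult_left_mono) (rule bp)
    then show ?thesis using a_le[of "x - y"] by (simp add: C_def)
  qed
  have near: "\<omega> y \<le> (1 - \<eta>) powr (- p) * \<omega> x" if "norm (x - y) < \<eta> * norm x" for x y
  proof -
    have "(1 - \<eta>) * (1 + norm x) \<le> 1 + norm y"
      using that \<eta> norm_triangle_ineq2[of x y] by (simp add: algebra_simps)
    then have "\<omega> y \<le> ((1 - \<eta>) * (1 + norm x)) powr (- p)"
      unfolding \<omega>_def using p \<eta> by (intro powr_mono2') (auto intro!: mult_pos_pos add_pos_nonneg)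
    then show ?thesis by (simp add: powr_mult \<omega>_def)
  qed
  have "(\<lambda>n. LINT y|lborel. min (inverse (real (Suc n))) (\<omega> y)) \<longlonglongrightarrow> (LINT y::'a|lborel. min 0 (\<omega> y))"
  proof (rule integral_dominated_convergence[OF _ _ \<omega>_int])
    show "AE y in lborel. (\<lambda>n. min (inverse (real (Suc n))) (\<omega> y)) \<longlonglongrightarrow> min 0 (\<omega> y)"
      by (intro AE_I2 tendsto_min LIMSEQ_inverse_real_of_nat tendsto_const)
    show "AE y in lborel. norm (min (inverse (real (Suc n))) (\<omega> y)) \<le> \<omega> y" for n
      using \<omega>_pos by (auto simp: min_def less_imp_le)
  qed measurable
  moreover have "min 0 (\<omega> y) = 0" for y using \<omega>_pos[of y] by simp
  ultimately have "(\<lambda>n. C * (LINT y|lborel. min (inverse (real (Suc n))) (\<omega> y))) \<longlonglongrightarrow> C * 0"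
    by (intro tendsto_intros) simp
  then have "\<forall>\<^sub>F n in sequentially. C * (LINT y|lborel. min (inverse (real (Suc n))) (\<omega> y)) < (\<kappa> - 1) / 2"
    by (rule order_tendstoD) (use \<kappa> in simp)
  then obtain n where n: "C * (LINT y|lborel. min (inverse (real (Suc n))) (\<omega> y)) < (\<kappa> - 1) / 2"
    using eventually_happens'[OF sequentially_bot] by blast
  define l where "l = inverse (real (Suc n))"
  define w where "w = (\<lambda>y. min l (\<omega> y))"
  have l: "0 < l" "l \<le> 1" by (auto simp: l_def field_simps)
  have [measurable]: "w \<in> borel_measurable borel" unfolding w_def by measurable
  have w: "0 \<le> w y" "w y \<le> l" "w y \<le> \<omega> y" for y using l \<omega>_pos[of y] by (auto simp: w_def)
  have w_int: "integrable lborel w"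
    by (rule Bochner_Integration.integrable_bound[OF \<omega>_int]) (use w \<omega>_pos in \<open>auto simp: less_imp_le\<close>)
  have "conv a w x \<le> \<kappa> * w x" for x
  proof -
    have pt: "a (x - y) * w y \<le> ((1 - \<eta>) powr (- p) * \<omega> x) * a (x - y) + (C * \<omega> x) * w y" for y
    proof (cases "norm (x - y) < \<eta> * norm x")
      case True
      have "w y \<le> (1 - \<eta>) powr (- p) * \<omega> x" using near[OF True] w(3)[of y] by linarith
      then have "w y * a (x - y) \<le> ((1 - \<eta>) powr (- p) * \<omega> x) * a (x - y)"
        by (rule mult_right_mono) (rule nonneg)
      moreover have "0 \<le> (C * \<omega> x) * w y" using \<open>C \<ge> 0\<close> \<omega>_pos[of x] w by simp
      ultimately show ?thesis by (simp add: mult.commute)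
    next
      case False
      then have "a (x - y) * w y \<le> (C * \<omega> x) * w y" using far[of x y] w by (intro mult_right_mono) auto
      moreover have "0 \<le> ((1 - \<eta>) powr (- p) * \<omega> x) * a (x - y)" using \<omega>_pos[of x] nonneg by simp
      ultimately show ?thesis by linarith
    qed
    have "conv a w x \<le> (LINT y|lborel. ((1 - \<eta>) powr (- p) * \<omega> x) * a (x - y) + (C * \<omega> x) * w y)"
      unfolding conv_def by (rule integral_mono[OF _ _ pt])
        (intro Bochner_Integration.integrable_add integrable_mult_right integrable_conv_integrand integrable_reflected w_int)+
    also have "\<dots> = ((1 - \<eta>) powr (- p) + C * (LINT y|lborel. w y)) * \<omega> x"
      using integrable_reflected[of x] w_int by (simp add: integral_reflected algebra_simps)
    also have "\<dots> \<le> \<kappa> * \<omega> x"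
    proof (rule mult_right_mono)
      show "(1 - \<eta>) powr (- p) + C * (LINT y|lborel. w y) \<le> \<kappa>"
        using \<eta>(3) n[folded l_def w_def] by (simp add: field_simps)
    qed (use \<omega>_pos[of x] in simp)
    finally have 1: "conv a w x \<le> \<kappa> * \<omega> x" .
    \<comment> \<open>Where the cap is active the previous estimate says too little; there it is
      enough that an average of values at most l is at most l.\<close>
    have "\<bar>conv a w x\<bar> \<le> l"
      by (rule conv_bound) (use w in auto)
    moreover have "l \<le> \<kappa> * l" using l \<kappa> by simp
    ultimately have "conv a w x \<le> \<kappa> * l" by linarith
    with 1 show ?thesis by (simp add: w_def min_def)
  qed
  then show ?thesis using that[of l] l by (simp add: w_def \<omega>_def)
qed

text \<open>Since \<open>\<bar>x\<bar> \<le> \<bar>y\<bar> + \<bar>x - y\<bar>\<close>, the ratio \<open>conv a w / w\<close> is at most \<open>\<integral> a(z) e\<^bsup>\<mu>\<bar>z\<bar>\<^esup> dz\<close>, which tends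
  to 1 as \<open>\<mu> \<rightarrow> 0\<close>.\<close>

lemma exp_weight_supersolution:
  fixes \<delta> \<rho> :: real
  assumes \<delta>: "0 < \<delta>" and \<rho>: "0 < \<rho>" and a_le: "\<And>x. a x \<le> b * exp (- \<delta> * norm x)"
    and \<kappa>: "\<kappa> > 1"
  obtains \<mu> where "0 < \<mu>" "\<mu> \<le> \<rho>"
    "\<And>x. conv a (\<lambda>y. exp (- \<mu> * norm y)) x \<le> \<kappa> * exp (- \<mu> * norm x)"
proof -
  \<comment> \<open>The cap \<delta> / 2 leaves half of the decay of \<open>a\<close> for an
    integrable majorant independent of n. The cap \<rho> lets the caller keep the weight above its
    source term.\<close>
  define \<mu> where "\<mu> n = min \<rho> (\<delta> / 2) * inverse (real (Suc n))" for n
  define g where "g n z = a z * exp (\<mu> n * norm z)" for n z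
  have [measurable]: "g n \<in> borel_measurable borel" for n unfolding g_def by measurable
  have \<mu>: "0 < \<mu> n" "\<mu> n \<le> \<rho>" "\<mu> n \<le> \<delta> / 2" for n
  proof -
    show "0 < \<mu> n" using \<delta> \<rho> by (auto simp: \<mu>_def)
    have "\<mu> n \<le> min \<rho> (\<delta> / 2)"
      unfolding \<mu>_def using \<delta> \<rho> by (intro mult_left_le) (auto simp: field_simps)
    then show "\<mu> n \<le> \<rho>" "\<mu> n \<le> \<delta> / 2" by auto
  qed
  have b: "b \<ge> 0" using a_le[of 0] nonneg[of 0] by simp
  have dom: "integrable lborel (\<lambda>z::'a. b * exp (- (\<delta> / 2) * norm z))"
    using \<delta> by (intro integrable_mult_right integrable_exp_norm) simp
  have g_le: "norm (g n z) \<le> b * exp (- (\<delta> / 2) * norm z)" for n z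
  proof -
    have "g n z \<le> (b * exp (- \<delta> * norm z)) * exp ((\<delta> / 2) * norm z)"
      unfolding g_def using mult_right_mono[OF \<mu>(3)[of n] norm_ge_zero[of z]] b a_le[of z] by (intro mult_mono) auto
    also have "\<dots> = b * exp (- (\<delta> / 2) * norm z)"
      by (simp add: mult.assoc field_simps flip: exp_add)
    finally show ?thesis using nonneg[of z] by (simp add: g_def)
  qed
  have g_int: "integrable lborel (g n)" for n
    by (rule Bochner_Integration.integrable_bound[OF dom]) (use g_le[of n] b in auto)
  have "\<mu> \<longlonglongrightarrow> min \<rho> (\<delta> / 2) * 0"
    unfolding \<mu>_def by (intro tendsto_intros LIMSEQ_inverse_real_of_nat)
  then have \<mu>0: "\<mu> \<longlonglongrightarrow> 0" by simp
  have "(\<lambda>n. LINT z|lborel. g n z) \<longlonglongrightarrow> (LINT z|lborel. a z * exp (0 * norm z))"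
  proof (rule integral_dominated_convergence[OF _ _ dom])
    show "AE z in lborel. (\<lambda>n. g n z) \<longlonglongrightarrow> a z * exp (0 * norm z)"
      unfolding g_def by (intro AE_I2 tendsto_intros \<mu>0)
  qed (use g_le in auto)
  then have "\<forall>\<^sub>F n in sequentially. (LINT z|lborel. g n z) < \<kappa>"
    by (rule order_tendstoD) (use \<kappa> int_1 in simp)
  then obtain n where n: "(LINT z|lborel. g n z) < \<kappa>"
    using eventually_happens'[OF sequentially_bot] by blast
  let ?w = "\<lambda>y::'a. exp (- \<mu> n * norm y)"
  have "conv a ?w x \<le> \<kappa> * ?w x" for x
  proof -
    have pt: "a (x - y) * ?w y \<le> ?w x * g n (x - y)" for y
    proof -
      have "\<mu> n * norm x \<le> \<mu> n * (norm y + norm (x - y))"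
        using \<mu>(1)[of n] norm_triangle_sub[of x y] by (intro mult_left_mono) auto
      then have "?w y \<le> exp (- \<mu> n * norm x + \<mu> n * norm (x - y))" by (simp add: algebra_simps)
      then have "a (x - y) * ?w y \<le> a (x - y) * (?w x * exp (\<mu> n * norm (x - y)))"
        unfolding exp_add by (rule mult_left_mono) (rule nonneg)
      then show ?thesis by (simp add: g_def ac_simps)
    qed
    have "conv a ?w x \<le> (LINT y|lborel. ?w x * g n (x - y))"
      unfolding conv_def
    proof (rule integral_mono[OF _ _ pt])
      show "integrable lborel (\<lambda>y. a (x - y) * ?w y)"
        by (rule integrable_conv_integrand_bounded[where B = 1]) (use \<mu>(1)[of n] in auto)
    qed (intro integrable_mult_right integrable_reflect g_int)
    also have "\<dots> = ?w x * (LINT z|lborel. g n z)"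
      by (simp add: integral_reflect_at)
    also have "\<dots> \<le> ?w x * \<kappa>" using n by (intro mult_left_mono) auto
    finally show ?thesis by (simp add: mult.commute)
  qed
  then show ?thesis using that[of "\<mu> n"] \<mu>[of n] by blast
qed

end

section \<open>The Cauchy problem\<close>

locale cauchy_problem = kernel a for a :: "'a::euclidean_space \<Rightarrow> real" +
  fixes m :: real and f :: "'a \<Rightarrow>\<^sub>C real"
  assumes m_pos: "m > 0"
    and f_int: "integrable lborel (apply_bcontfun f)"
    and f_nonneg: "\<And>x. 0 \<le> apply_bcontfun f x"

sublocale cauchy_problem \<subseteq> contraction conv_Cb "1 + m"
proof -
  interpret bounded_linear conv_Cb by (rule bounded_linear_conv_Cb)
  show "contraction conv_Cb (1 + m)"
    by unfold_locales (use norm_conv_Cb m_pos in auto)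
qed

context cauchy_problem
begin

text \<open>These are the iterates as plain functions, on which sign and L^1 norm, invisible to the
  sup norm, can be followed by induction.\<close>

definition iter :: "nat \<Rightarrow> 'a \<Rightarrow> real" where
  "iter k = apply_bcontfun ((conv_Cb ^^ k) f)"

abbreviation U where "U \<equiv> duhamel_series f"
abbreviation N where "N \<equiv> neumann_series f"

lemma iter_0: "iter 0 = apply_bcontfun f"
  and iter_Suc: "iter (Suc k) = conv a (iter k)"
  by (auto simp: iter_def apply_conv_Cb)

lemma iter_borel [measurable]: "iter k \<in> borel_measurable borel"
  by (simp add: iter_def)

lemma iter_nonneg: "0 \<le> iter k x"
proof (induction k arbitrary: x)
  case (Suc k)
  then show ?case
    unfolding iter_Suc conv_def by (intro integral_nonneg_AE) (auto simp: nonneg)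
qed (simp add: iter_0 f_nonneg)

lemma integrable_iter: "integrable lborel (iter k)"
  by (induction k) (auto simp: iter_0 iter_Suc f_int intro: integrable_conv int)

lemma integral_iter: "(LINT x|lborel. iter k x) = (LINT x|lborel. apply_bcontfun f x)"
  by (induction k) (auto simp: iter_0 iter_Suc integral_conv[OF int integrable_iter] int_1)

lemma apply_series:
  assumes "summable (\<lambda>k. \<bar>p k\<bar>)"
  shows "apply_bcontfun (\<Sum>k. p k *\<^sub>R (conv_Cb ^^ k) f) x = (\<Sum>k. p k * iter k x)"
    and "summable (\<lambda>k. p k * iter k x)"
  using bounded_linear.suminf[OF bounded_linear_apply_bcontfun[of x] summable_scaleR_iterates[OF assms, of f]]
    bounded_linear.summable[OF bounded_linear_apply_bcontfun[of x] summable_scaleR_iterates[OF assms, of f]]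
  by (simp_all add: iter_def)

text \<open>All iterates are nonnegative with the same integral as f, so absolutely summable
  coefficients give an L^1 bound. Coefficients of either sign are allowed because differences of
  Duhamel coefficients are inserted later.\<close>

lemma
  assumes p: "summable (\<lambda>k. \<bar>p k\<bar>)"
  shows integrable_series: "integrable lborel (apply_bcontfun (\<Sum>k. p k *\<^sub>R (conv_Cb ^^ k) f))"
    and integral_abs_series_le: "(LINT x|lborel. \<bar>apply_bcontfun (\<Sum>k. p k *\<^sub>R (conv_Cb ^^ k) f) x\<bar>)
      \<le> (\<Sum>k. \<bar>p k\<bar>) * (LINT x|lborel. apply_bcontfun f x)"
proof -
  have eq: "apply_bcontfun (\<Sum>k. p k *\<^sub>R (conv_Cb ^^ k) f) = (\<lambda>x. \<Sum>k. p k * iter k x)"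
    by (rule ext) (rule apply_series[OF p])
  have abs_eq: "\<bar>p k * iter k x\<bar> = \<bar>p k\<bar> * iter k x" for k x
    using iter_nonneg[of k x] by (simp add: abs_mult)
  have s: "summable (\<lambda>k. \<bar>p k\<bar> * iter k x)" for x
    using apply_series(2)[of "\<lambda>k. \<bar>p k\<bar>"] p by simp
  have si: "summable (\<lambda>k. LINT x|lborel. \<bar>p k\<bar> * iter k x)"
    by (simp add: integral_iter summable_mult2 p)
  have i: "integrable lborel (\<lambda>x. \<Sum>k. p k * iter k x)"
    by (rule integrable_suminf) (use integrable_iter s si in \<open>auto simp: abs_eq\<close>)
  then show "integrable lborel (apply_bcontfun (\<Sum>k. p k *\<^sub>R (conv_Cb ^^ k) f))"
    by (simp only: eq)
  have "integrable lborel (\<lambda>x. \<Sum>k. \<bar>p k\<bar> * iter k x)"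
    by (rule integrable_suminf) (use integrable_iter s si iter_nonneg in auto)
  moreover have "\<bar>\<Sum>k. p k * iter k x\<bar> \<le> (\<Sum>k. \<bar>p k\<bar> * iter k x)" for x
    using summable_rabs[of "\<lambda>k. p k * iter k x"] s by (simp add: abs_eq)
  ultimately have "(LINT x|lborel. \<bar>\<Sum>k. p k * iter k x\<bar>) \<le> (LINT x|lborel. (\<Sum>k. \<bar>p k\<bar> * iter k x))"
    using i by (intro integral_mono) auto
  also have "\<dots> = (\<Sum>k. LINT x|lborel. \<bar>p k\<bar> * iter k x)"
    by (rule integral_suminf) (use integrable_iter s si iter_nonneg in auto)
  also have "\<dots> = (\<Sum>k. \<bar>p k\<bar>) * (LINT x|lborel. apply_bcontfun f x)"
    by (simp add: integral_iter suminf_mult2[OF p])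
  finally show "(LINT x|lborel. \<bar>apply_bcontfun (\<Sum>k. p k *\<^sub>R (conv_Cb ^^ k) f) x\<bar>)
      \<le> (\<Sum>k. \<bar>p k\<bar>) * (LINT x|lborel. apply_bcontfun f x)"
    by (simp only: eq)
qed

lemma summable_abs_coeffs:
  "summable (\<lambda>k. \<bar>1 / (1 + m) ^ Suc k\<bar>)"
  "t \<ge> 0 \<Longrightarrow> summable (\<lambda>k. \<bar>duhamel_coeff (1 + m) k t\<bar>)"
  using summable_inverse_power[OF c] summable_duhamel_coeff[OF c, of t] duhamel_coeff_nonneg[of "1 + m" t] m_pos
  by auto

lemma N_eq: "apply_bcontfun N x = (\<Sum>k. 1 / (1 + m) ^ Suc k * iter k x)"
  and N_summable: "summable (\<lambda>k. 1 / (1 + m) ^ Suc k * iter k x)"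
  unfolding neumann_series_def by (rule apply_series[OF summable_abs_coeffs(1)])+

lemma U_eq: "t \<ge> 0 \<Longrightarrow> apply_bcontfun (U t) x = (\<Sum>k. duhamel_coeff (1 + m) k t * iter k x)"
  and U_summable: "t \<ge> 0 \<Longrightarrow> summable (\<lambda>k. duhamel_coeff (1 + m) k t * iter k x)"
  unfolding duhamel_series_def by (rule apply_series[OF summable_abs_coeffs(2)], assumption)+

lemma integrable_N: "integrable lborel (apply_bcontfun N)"
  unfolding neumann_series_def by (rule integrable_series[OF summable_abs_coeffs(1)])

lemma integrable_U: "t \<ge> 0 \<Longrightarrow> integrable lborel (apply_bcontfun (U t))"
  unfolding duhamel_series_def by (rule integrable_series[OF summable_abs_coeffs(2)])

lemma U_bounds:
  assumes "t \<ge> 0"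
  shows "0 \<le> apply_bcontfun (U t) x" "apply_bcontfun (U t) x \<le> apply_bcontfun N x"
proof -
  have p: "0 \<le> duhamel_coeff (1 + m) k t" "duhamel_coeff (1 + m) k t \<le> 1 / (1 + m) ^ Suc k" for k
    using duhamel_coeff_nonneg[of "1 + m" t] duhamel_coeff_le[of "1 + m" t] m_pos assms by auto
  show "0 \<le> apply_bcontfun (U t) x"
    unfolding U_eq[OF assms] by (intro suminf_nonneg U_summable[OF assms] mult_nonneg_nonneg p iter_nonneg)
  show "apply_bcontfun (U t) x \<le> apply_bcontfun N x"
    unfolding U_eq[OF assms] N_eq
    by (intro suminf_le U_summable[OF assms] N_summable mult_right_mono p iter_nonneg)
qed

text \<open>A series with nonnegative terms dominates each single term. The cases k = 0 and k = 1
  produce the lower bounds for the stationary solution.\<close>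

lemma iter_le_N: "iter k x \<le> (1 + m) ^ Suc k * apply_bcontfun N x"
proof -
  have "(\<Sum>j\<in>{k}. 1 / (1 + m) ^ Suc j * iter j x) \<le> apply_bcontfun N x"
    unfolding N_eq by (rule sum_le_suminf[OF N_summable]) (use iter_nonneg m_pos in auto)
  then have "iter k x / (1 + m) ^ Suc k \<le> apply_bcontfun N x" by simp
  then show ?thesis
    using m_pos by (subst (asm) pos_divide_le_eq) (auto simp: mult.commute)
qed

section \<open>Convolution powers and the kernel G_m\<close>

lemma conv_pow_props:
  "conv_pow a k \<in> borel_measurable borel" "integrable lborel (conv_pow a k)"
  "0 \<le> conv_pow a k x" "conv_pow a k x \<le> amax" "conv (conv_pow a k) (apply_bcontfun f) = iter (Suc k)"
proof (induction k arbitrary: x)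
  case 0
  case 1 show ?case by simp
  case 2 show ?case by (simp add: int)
  case 3 show ?case by (simp add: nonneg)
  case 4 show ?case by (simp add: le_amax)
  case 5 show ?case by (simp add: iter_Suc iter_0)
next
  case (Suc k)
  have eq: "conv_pow a (Suc k) = conv a (conv_pow a k)"
    by (auto simp: conv_def)
  note [measurable] = Suc(1)
  case 1 show ?case unfolding eq by measurable
  case 2 show ?case unfolding eq by (rule integrable_conv[OF int Suc(2)])
  case 3 show ?case
    unfolding eq conv_def by (intro integral_nonneg_AE AE_I2 mult_nonneg_nonneg nonneg Suc(3))
  case 4 show ?case
    using conv_bound[of "conv_pow a k" amax x] Suc(3,4) unfolding eq by (auto simp: abs_le_iff)
  case 5 show ?case
    unfolding eq by (simp only: conv_assoc[OF borel abs_le_amax(1) Suc(2) f_int] Suc(5) iter_Suc[of "Suc k"])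
qed

text \<open>All terms are nonnegative, so sum and integral may be interchanged, and the integral of
  G_m against f becomes the sum of c^{-(k+1)} A^{k+1} f with c = 1 + m. The separate summand f
  supplies the missing term k = 0, and the prefactor 1 / c the missing power.\<close>

lemma u_hat_eq_N: "u_hat a m (apply_bcontfun f) = apply_bcontfun N"
proof
  fix x
  let ?c = "1 + m"
  define h where "h k y = conv_pow a k (x - y) / ?c ^ (k + 1) * apply_bcontfun f y" for k y
  have [measurable]: "conv_pow a k \<in> borel_measurable borel" for k by (rule conv_pow_props)
  have h_nonneg: "0 \<le> h k y" for k y
    using conv_pow_props(3) f_nonneg m_pos by (simp add: h_def)
  have G: "summable (\<lambda>k. conv_pow a k z / ?c ^ (k + 1))" for z
  proof (rule summable_comparison_test'[OF summable_mult[OF summable_inverse_power[OF c], of amax], of 0])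
    show "norm (conv_pow a k z / ?c ^ (k + 1)) \<le> amax * (1 / ?c ^ Suc k)" for k
      using conv_pow_props(3,4)[of k z] m_pos by (simp add: divide_right_mono)
  qed
  have h_sum: "summable (\<lambda>k. h k y)" for y
    unfolding h_def by (rule summable_mult2[OF G])
  have h_int: "integrable lborel (h k)" for k
  proof -
    have "integrable lborel (\<lambda>y. conv_pow a k (x - y) / ?c ^ (k + 1) * apply_bcontfun f y)"
      by (rule integrable_mult_bounded[OF f_int, where B = "amax / ?c ^ (k + 1)"])
        (use conv_pow_props(3,4)[of k] m_pos in \<open>auto intro!: divide_right_mono\<close>)
    then show ?thesis by (simp add: h_def[abs_def])
  qed
  have h_integral: "(LINT y|lborel. h k y) = 1 / ?c ^ Suc k * iter (Suc k) x" for k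
    unfolding conv_pow_props(5)[of k, symmetric] conv_def by (simp add: h_def mult.commute mult.left_commute)
  have tail: "summable (\<lambda>k. 1 / ?c ^ Suc k * iter (Suc k) x)"
    using summable_mult[OF summable_Suc_iff[THEN iffD2, OF N_summable[of x]], of ?c] m_pos by simp
  have "(LINT y|lborel. G_kernel a m (x - y) * apply_bcontfun f y) = (LINT y|lborel. (\<Sum>k. h k y))"
    unfolding G_kernel_def h_def by (simp only: suminf_mult2[OF G])
  also have "\<dots> = (\<Sum>k. LINT y|lborel. h k y)"
  proof (rule integral_suminf[OF h_int])
    show "AE y in lborel. summable (\<lambda>k. norm (h k y))" using h_sum h_nonneg by simp
    show "summable (\<lambda>k. LINT y|lborel. norm (h k y))"
      using tail h_nonneg by (simp add: h_integral del: power_Suc)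
  qed
  also have "\<dots> = (\<Sum>k. 1 / ?c ^ Suc k * iter (Suc k) x)"
    by (simp only: h_integral)
  finally have "u_hat a m (apply_bcontfun f) x = 1 / ?c * (iter 0 x + (\<Sum>k. 1 / ?c ^ Suc k * iter (Suc k) x))"
    by (simp add: u_hat_def iter_0)
  also have "\<dots> = apply_bcontfun N x"
  proof -
    have "(\<Sum>k. 1 / ?c ^ Suc (Suc k) * iter (Suc k) x) = (\<Sum>k. 1 / ?c * (1 / ?c ^ Suc k * iter (Suc k) x))"
      by (intro suminf_cong) simp
    also have "\<dots> = 1 / ?c * (\<Sum>k. 1 / ?c ^ Suc k * iter (Suc k) x)"
      by (rule suminf_mult[OF tail])
    finally have "(\<Sum>k. 1 / ?c ^ Suc (Suc k) * iter (Suc k) x) = 1 / ?c * (\<Sum>k. 1 / ?c ^ Suc k * iter (Suc k) x)" .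
    moreover have "apply_bcontfun N x = (\<Sum>k. 1 / ?c ^ Suc (Suc k) * iter (Suc k) x) + 1 / ?c * iter 0 x"
      using suminf_split_head[OF N_summable[of x]] by (simp add: N_eq)
    ultimately show ?thesis by (simp only: distrib_left add.commute)
  qed
  finally show "u_hat a m (apply_bcontfun f) x = apply_bcontfun N x" .
qed

lemma N_le_weight:
  assumes [measurable]: "W \<in> borel_measurable borel" and W: "\<And>x. 0 \<le> W x" "\<And>x. W x \<le> B"
    and super: "\<And>x. conv a W x \<le> \<kappa> * W x" and \<kappa>: "0 \<le> \<kappa>" "\<kappa> < 1 + m"
    and f_le: "\<And>x. apply_bcontfun f x \<le> C * W x" and C: "0 \<le> C"
  shows "apply_bcontfun N x \<le> C / (1 + m - \<kappa>) * W x"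
proof -
  have W_int: "integrable lborel (\<lambda>y. a (x - y) * W y)" for x
    by (rule integrable_conv_integrand_bounded[where B = B]) (use W in auto)
  have iter_le: "iter k x \<le> C * \<kappa> ^ k * W x" for k x
  proof (induction k arbitrary: x)
    case (Suc k)
    have "iter (Suc k) x \<le> conv a (\<lambda>y. C * \<kappa> ^ k * W y) x"
      unfolding iter_Suc
      by (rule conv_mono[OF integrable_conv_integrand[OF integrable_iter] _ Suc])
        (use integrable_mult_right[OF W_int[of x], of "C * \<kappa> ^ k"] in \<open>simp add: ac_simps\<close>)
    also have "\<dots> = C * \<kappa> ^ k * conv a W x"
      unfolding conv_def by (simp add: mult.left_commute[of "a _"])
    also have "\<dots> \<le> C * \<kappa> ^ k * (\<kappa> * W x)"
      using super \<kappa> C by (intro mult_left_mono) auto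
    finally show ?case by (simp add: ac_simps)
  qed (use f_le in \<open>simp add: iter_0\<close>)
  have geo: "(\<lambda>k. (\<kappa> / (1 + m)) ^ k) sums (1 / (1 - \<kappa> / (1 + m)))"
    using \<kappa> m_pos by (intro geometric_sums) auto
  have "1 / (1 - \<kappa> / (1 + m)) = (1 + m) / (1 + m - \<kappa>)"
    using m_pos \<kappa> by (simp add: field_simps)
  then have "C * W x / (1 + m) * (1 / (1 - \<kappa> / (1 + m))) = C / (1 + m - \<kappa>) * W x"
    using m_pos by simp
  then have "(\<lambda>k. C * W x / (1 + m) * (\<kappa> / (1 + m)) ^ k) sums (C / (1 + m - \<kappa>) * W x)"
    using sums_mult[OF geo, of "C * W x / (1 + m)"] by (simp only:)
  moreover have "1 / (1 + m) ^ Suc k * iter k x \<le> C * W x / (1 + m) * (\<kappa> / (1 + m)) ^ k" for k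
  proof -
    have "1 / (1 + m) ^ Suc k * iter k x \<le> 1 / (1 + m) ^ Suc k * (C * \<kappa> ^ k * W x)"
      using m_pos by (intro mult_left_mono iter_le) auto
    then show ?thesis by (simp add: power_divide ac_simps)
  qed
  ultimately show ?thesis
    unfolding N_eq using N_summable[of x] by (intro sums_le[OF _ summable_sums]) auto
qed

end

section \<open>L^2 convergence by interpolation\<close>

lemma L2_norm_bcontfun_le:
  fixes v :: "'a::euclidean_space \<Rightarrow>\<^sub>C real"
  assumes "integrable lborel (apply_bcontfun v)" "(LINT x|lborel. \<bar>apply_bcontfun v x\<bar>) \<le> K"
  shows "L2_norm (apply_bcontfun v) \<le> sqrt (norm v * K)"
  unfolding L2_norm_def
  using square_integrable_bcontfun(2)[OF assms(1)] mult_left_mono[OF assms(2), of "norm v"]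
  by (intro real_sqrt_le_mono) simp

text \<open>The filter is arbitrary because the lemma serves both the limit t to infinity and the
  difference quotients as s tends to t.\<close>

lemma L2_norm_tendsto_0:
  fixes v :: "'b \<Rightarrow> 'a::euclidean_space \<Rightarrow>\<^sub>C real"
  assumes "\<forall>\<^sub>F s in F. integrable lborel (apply_bcontfun (v s)) \<and> (LINT x|lborel. \<bar>apply_bcontfun (v s) x\<bar>) \<le> K"
    and "((\<lambda>s. norm (v s)) \<longlongrightarrow> 0) F"
  shows "((\<lambda>s. L2_norm (apply_bcontfun (v s))) \<longlongrightarrow> 0) F"
proof (rule Lim_null_comparison)
  show "\<forall>\<^sub>F s in F. norm (L2_norm (apply_bcontfun (v s))) \<le> sqrt (norm (v s) * K)"
    using assms(1) by eventually_elim (use L2_norm_bcontfun_le in \<open>auto simp: L2_norm_def\<close>)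
  have "((\<lambda>s. sqrt (norm (v s) * K)) \<longlongrightarrow> sqrt (0 * K)) F"
    by (intro tendsto_intros assms(2))
  then show "((\<lambda>s. sqrt (norm (v s) * K)) \<longlongrightarrow> 0) F" by simp
qed

lemma L2_norm_tendsto_0_iff:
  "((\<lambda>s. L2_norm (w s)) \<longlongrightarrow> 0) F \<longleftrightarrow> ((\<lambda>s. LINT x|lborel. (w s x)\<^sup>2) \<longlongrightarrow> 0) F"
proof
  assume "((\<lambda>s. L2_norm (w s)) \<longlongrightarrow> 0) F"
  then have "((\<lambda>s. (L2_norm (w s))\<^sup>2) \<longlongrightarrow> 0\<^sup>2) F" by (rule tendsto_power)
  then show "((\<lambda>s. LINT x|lborel. (w s x)\<^sup>2) \<longlongrightarrow> 0) F" by (simp add: L2_norm_def)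
next
  assume "((\<lambda>s. LINT x|lborel. (w s x)\<^sup>2) \<longlongrightarrow> 0) F"
  then show "((\<lambda>s. L2_norm (w s)) \<longlongrightarrow> 0) F"
    using tendsto_real_sqrt[of "\<lambda>s. LINT x|lborel. (w s x)\<^sup>2" 0 F] by (simp add: L2_norm_def)
qed

text \<open>On [0,R] the derivative e^{-cr} r^k / k! is at most R^k / k!. These Lipschitz constants
  sum to e^R, which makes the whole series Lipschitz in L^1.\<close>

lemma duhamel_coeff_lipschitz:
  assumes "c > 0" "s \<in> {0..R}" "t \<in> {0..R}"
  shows "\<bar>duhamel_coeff c k s - duhamel_coeff c k t\<bar> \<le> R ^ k / fact k * \<bar>s - t\<bar>"
proof -
  have "norm (duhamel_coeff c k s - duhamel_coeff c k t) \<le> R ^ k / fact k * norm (s - t)"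
  proof (rule field_differentiable_bound)
    show "(duhamel_coeff c k has_field_derivative exp (- c * r) * r ^ k / fact k) (at r within {0..R})" for r
      using duhamel_coeff_deriv[of c k r] assms(1) by (auto intro: has_field_derivative_at_within)
    show "norm (exp (- c * r) * r ^ k / fact k) \<le> R ^ k / fact k" if "r \<in> {0..R}" for r
    proof -
      have "exp (- c * r) * r ^ k \<le> 1 * R ^ k"
        using that assms(1) by (intro mult_mono power_mono) auto
      then show ?thesis using that by (auto simp: divide_right_mono)
    qed
  qed (use assms in auto)
  then show ?thesis by simp
qed

section \<open>Solution and uniqueness in C_b and in L^2\<close>

context cauchy_problem
begin

lemma L0_Cb_eq: "L0_Cb a v - m *\<^sub>R v = conv_Cb v - (1 + m) *\<^sub>R v"
  by (simp add: conv_Cb_def scaleR_add_left)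

lemma cauchy_sol_eq:
  assumes "t \<ge> 0"
  shows "cauchy_sol a m f t = U t"
  unfolding cauchy_sol_def L0_Cb_eq by (rule integral_op_exp_eq_duhamel_series[OF assms])

lemma cauchy_sol_has_vector_derivative:
  assumes "t \<ge> 0"
  shows "(cauchy_sol a m f has_vector_derivative
    (L0_Cb a (cauchy_sol a m f t) - m *\<^sub>R cauchy_sol a m f t + f)) (at t within {0..})"
  unfolding L0_Cb_eq cauchy_sol_eq[OF assms]
  by (rule has_vector_derivative_transform[OF _ _ has_vector_derivative_at_within[OF
        duhamel_series_has_vector_derivative[OF assms]]]) (use assms cauchy_sol_eq in auto)

lemma is_cauchy_solution_Cb_cauchy_sol: "is_cauchy_solution_Cb a m f (cauchy_sol a m f)"
  unfolding is_cauchy_solution_Cb_def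
  using cauchy_sol_has_vector_derivative cauchy_sol_eq[of 0] duhamel_series_0 by simp

lemma is_cauchy_solution_Cb_unique:
  assumes "is_cauchy_solution_Cb a m f v" "t \<ge> 0"
  shows "v t = cauchy_sol a m f t"
proof (rule linear_ode_unique[OF bounded_linear_generator _ _ _ assms(2)])
  have "(w has_vector_derivative conv_Cb (w t) - (1 + m) *\<^sub>R w t + f) (at t within {0..})"
    if "is_cauchy_solution_Cb a m f w" "t \<ge> 0" for w t
    using that unfolding is_cauchy_solution_Cb_def L0_Cb_eq by blast
  then show "(v has_vector_derivative conv_Cb (v t) - (1 + m) *\<^sub>R v t + f) (at t within {0..})"
    "(cauchy_sol a m f has_vector_derivative conv_Cb (cauchy_sol a m f t) - (1 + m) *\<^sub>R cauchy_sol a m f t + f) (at t within {0..})"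
    if "t \<ge> 0" for t
    using assms(1) is_cauchy_solution_Cb_cauchy_sol that by blast+
  show "v 0 = cauchy_sol a m f 0"
    using assms(1) is_cauchy_solution_Cb_cauchy_sol by (simp add: is_cauchy_solution_Cb_def)
qed

text \<open>Differentiability in the sup norm gives no control of L^1 norms. This Lipschitz estimate
  supplies the L^1 bound on difference quotients that interpolation requires.\<close>

lemma integral_abs_U_diff_le:
  assumes "s \<in> {0..R}" "t \<in> {0..R}"
  shows "(LINT x|lborel. \<bar>apply_bcontfun (U s - U t) x\<bar>)
    \<le> exp R * (LINT x|lborel. apply_bcontfun f x) * \<bar>s - t\<bar>"
proof -
  let ?p = "duhamel_coeff (1 + m)" and ?I = "LINT x|lborel. apply_bcontfun f x"
  have c0: "1 + m > 0" using m_pos by simp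
  have p: "summable (\<lambda>k. \<bar>?p k r\<bar>)" if "r \<in> {s, t}" for r
    using summable_abs_coeffs(2)[of r] that assms by auto
  have "U s - U t = (\<Sum>k. (?p k s - ?p k t) *\<^sub>R (conv_Cb ^^ k) f)"
    unfolding duhamel_series_def scaleR_diff_left
    by (intro suminf_diff summable_scaleR_iterates p) auto
  moreover have E: "(\<lambda>k. R ^ k / fact k * \<bar>s - t\<bar>) sums (exp R * \<bar>s - t\<bar>)"
    using exp_converges[of R] by (intro sums_mult2) (simp add: field_simps)
  have d: "summable (\<lambda>k. \<bar>?p k s - ?p k t\<bar>)"
    by (rule summable_comparison_test'[OF sums_summable[OF E], of 0])
      (use duhamel_coeff_lipschitz[OF c0 assms] in simp)
  ultimately have "(LINT x|lborel. \<bar>apply_bcontfun (U s - U t) x\<bar>) \<le> (\<Sum>k. \<bar>?p k s - ?p k t\<bar>) * ?I"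
    using integral_abs_series_le[OF d] by (simp only:)
  also have "(\<Sum>k. \<bar>?p k s - ?p k t\<bar>) \<le> exp R * \<bar>s - t\<bar>"
    using sums_le[OF duhamel_coeff_lipschitz[OF c0 assms] summable_sums[OF d] E] .
  also have "exp R * \<bar>s - t\<bar> * ?I = exp R * ?I * \<bar>s - t\<bar>" by simp
  finally show ?thesis
    using f_nonneg by (auto simp: mult_right_mono integral_nonneg_AE)
qed

text \<open>The remainder, difference quotient minus derivative, tends to 0 in the sup norm and has
  L^1 norm bounded near t, hence it tends to 0 in L^2.\<close>

lemma cauchy_sol_L2_derivative:
  assumes t: "t \<ge> 0"
  shows "((\<lambda>s. L2_norm (\<lambda>x. (apply_bcontfun (cauchy_sol a m f s) x - apply_bcontfun (cauchy_sol a m f t) x) / (s - t)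
      - (L0 a (apply_bcontfun (cauchy_sol a m f t)) x - m * apply_bcontfun (cauchy_sol a m f t) x + apply_bcontfun f x)))
    \<longlongrightarrow> 0) (at t within {0..})"
proof -
  let ?u = "cauchy_sol a m f" and ?I = "LINT x|lborel. apply_bcontfun f x"
  define g where "g = L0_Cb a (?u t) - m *\<^sub>R ?u t + f"
  define v where "v s = (1 / (s - t)) *\<^sub>R (?u s - ?u t) - g" for s
  have L0: "L0 a (apply_bcontfun (?u t)) x = apply_bcontfun (L0_Cb a (?u t)) x" for x
    by (simp add: apply_L0_Cb L0_eq_conv integrable_conv_integrand_Cb)
  have v_eq: "apply_bcontfun (v s) = (\<lambda>x. (apply_bcontfun (?u s) x - apply_bcontfun (?u t) x) / (s - t)
      - (L0 a (apply_bcontfun (?u t)) x - m * apply_bcontfun (?u t) x + apply_bcontfun f x))" for s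
    by (auto simp: v_def g_def L0 divide_inverse mult.commute)
  have u_int: "integrable lborel (apply_bcontfun (?u s))" if "s \<ge> 0" for s
    using integrable_U[OF that] by (simp add: cauchy_sol_eq[OF that])
  have "integrable lborel (\<lambda>x. conv a (apply_bcontfun (?u t)) x - apply_bcontfun (?u t) x - m * apply_bcontfun (?u t) x
      + apply_bcontfun f x)"
    by (intro Bochner_Integration.integrable_add Bochner_Integration.integrable_diff integrable_mult_right
        integrable_conv int u_int t f_int)
  then have g_int: "integrable lborel (apply_bcontfun g)"
    by (simp add: g_def apply_L0_Cb[abs_def] plus_bcontfun.rep_eq minus_bcontfun.rep_eq scaleR_bcontfun.rep_eq)
  have v_int: "integrable lborel (apply_bcontfun (v s))" if "s \<ge> 0" for s
  proof -
    have "integrable lborel (\<lambda>x. (1 / (s - t)) * (apply_bcontfun (?u s) x - apply_bcontfun (?u t) x) - apply_bcontfun g x)"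
      by (intro Bochner_Integration.integrable_diff integrable_mult_right u_int t that g_int)
    then show ?thesis by (simp add: v_def minus_bcontfun.rep_eq scaleR_bcontfun.rep_eq)
  qed
  \<comment> \<open>K is the L^1 Lipschitz constant of the solution on [0, t+1] plus the L^1 norm of
    the derivative g.\<close>
  define K where "K = exp (t + 1) * ?I + (LINT x|lborel. \<bar>apply_bcontfun g x\<bar>)"
  have bound: "(LINT x|lborel. \<bar>apply_bcontfun (v s) x\<bar>) \<le> K" if s: "s \<in> {0..t+1}" "s \<noteq> t" for s
  proof -
    let ?d = "apply_bcontfun (?u s - ?u t)"
    have d_int: "integrable lborel ?d"
      using Bochner_Integration.integrable_diff[OF u_int[of s] u_int[OF t]] s by (simp add: minus_bcontfun.rep_eq)
    have "(LINT x|lborel. \<bar>apply_bcontfun (v s) x\<bar>)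
        \<le> (LINT x|lborel. \<bar>1 / (s - t)\<bar> * \<bar>?d x\<bar> + \<bar>apply_bcontfun g x\<bar>)"
    proof (rule integral_mono)
      show "\<bar>apply_bcontfun (v s) x\<bar> \<le> \<bar>1 / (s - t)\<bar> * \<bar>?d x\<bar> + \<bar>apply_bcontfun g x\<bar>" for x
        unfolding abs_mult[symmetric] v_def by (simp del: abs_divide)
    qed (use v_int[of s] d_int g_int s in auto)
    also have "\<dots> = \<bar>1 / (s - t)\<bar> * (LINT x|lborel. \<bar>?d x\<bar>) + (LINT x|lborel. \<bar>apply_bcontfun g x\<bar>)"
      using d_int g_int by simp
    also have "\<bar>1 / (s - t)\<bar> * (LINT x|lborel. \<bar>?d x\<bar>) \<le> \<bar>1 / (s - t)\<bar> * (exp (t + 1) * ?I * \<bar>s - t\<bar>)"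
      using integral_abs_U_diff_le[of s "t + 1" t] s t
      by (intro mult_left_mono) (auto simp: cauchy_sol_eq)
    also have "\<dots> = exp (t + 1) * ?I" using s by (simp add: field_simps)
    finally show ?thesis by (simp add: K_def)
  qed
  have quot: "((\<lambda>s. norm ((?u s - ?u t) - (s - t) *\<^sub>R g) / norm (s - t)) \<longlongrightarrow> 0) (at t within {0..})"
    using cauchy_sol_has_vector_derivative[OF t]
    by (simp add: has_vector_derivative_def has_derivative_iff_norm g_def)
  have norm_eq: "norm ((?u s - ?u t) - (s - t) *\<^sub>R g) / norm (s - t) = norm (v s)" if "s \<noteq> t" for s
  proof -
    have "v s = (1 / (s - t)) *\<^sub>R ((?u s - ?u t) - (s - t) *\<^sub>R g)"
      using that by (simp add: v_def scaleR_diff_right)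
    then show ?thesis by (simp add: divide_inverse)
  qed
  have lim: "((\<lambda>s. norm (v s)) \<longlongrightarrow> 0) (at t within {0..})"
    by (rule Lim_transform_eventually[OF quot]) (use norm_eq in \<open>auto simp: eventually_at intro!: exI[of _ 1]\<close>)
  have "\<forall>\<^sub>F s in at t within {0..}. integrable lborel (apply_bcontfun (v s)) \<and> (LINT x|lborel. \<bar>apply_bcontfun (v s) x\<bar>) \<le> K"
    unfolding eventually_at using v_int bound by (intro exI[of _ 1]) (auto simp: dist_real_def)
  from L2_norm_tendsto_0[OF this lim] show ?thesis by (simp only: v_eq)
qed

lemma is_cauchy_solution_L2_cauchy_sol:
  "is_cauchy_solution_L2 a m (apply_bcontfun f) (\<lambda>t. apply_bcontfun (cauchy_sol a m f t))"
  unfolding is_cauchy_solution_L2_def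
  using cauchy_sol_L2_derivative square_integrable_bcontfun(1)[OF integrable_U] duhamel_series_0
  by (simp add: cauchy_sol_eq)

lemma is_cauchy_solution_L2_unique:
  assumes v: "is_cauchy_solution_L2 a m (apply_bcontfun f) v" and T: "T \<ge> 0"
  shows "AE x in lborel. v T x = apply_bcontfun (cauchy_sol a m f T) x"
proof -
  define u where "u t = apply_bcontfun (cauchy_sol a m f t)" for t
  have u: "is_cauchy_solution_L2 a m (apply_bcontfun f) u"
    using is_cauchy_solution_L2_cauchy_sol by (simp add: u_def[abs_def])
  have sq: "square_integrable (v t)" "square_integrable (u t)" if "t \<ge> 0" for t
    using u v that by (auto simp: is_cauchy_solution_L2_def)
  \<comment> \<open>h is the remainder whose L^2 norm tends to 0 for a solution. The remainder of v
    - u is the difference of the two remainders, since the source f cancels.\<close>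
  define h where "h w t s x = (w s x - w t x) / (s - t) - (L0 a (w t) x - m * w t x + apply_bcontfun f x)"
    for w :: "real \<Rightarrow> 'a \<Rightarrow> real" and t s x
  have h_sq: "square_integrable (h w t s)" if "square_integrable (w s)" "square_integrable (w t)" for w t s
  proof -
    have "square_integrable (\<lambda>x. (1 / (s - t)) * (w s x - w t x) - (conv a (w t) x - w t x - m * w t x + apply_bcontfun f x))"
      by (intro square_integrable_diff square_integrable_add square_integrable_scale square_integrable_conv that
          square_integrable_bcontfun f_int)
    then show ?thesis
      by (simp add: h_def[abs_def] L0_eq_conv integrable_conv_integrand_L2 that)
  qed
  have "AE x in lborel. v T x - u T x = 0"
  proof (rule conv_evolution_L2_zero[where w = "\<lambda>t x. v t x - u t x" and c = "1 + m"])
    show "square_integrable (\<lambda>x. v t x - u t x)" if "t \<ge> 0" for t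
      by (intro square_integrable_diff sq that)
    show "AE x in lborel. v 0 x - u 0 x = 0"
      using u v unfolding is_cauchy_solution_L2_def by (auto elim: eventually_elim2)
    show "1 \<le> 1 + m" using m_pos by simp
  next
    fix t :: real assume t: "t \<ge> 0"
    have lim: "((\<lambda>s. LINT x|lborel. (h w t s x)\<^sup>2) \<longlongrightarrow> 0) (at t within {0..})" if "w \<in> {v, u}" for w
      using u v t that unfolding is_cauchy_solution_L2_def L2_norm_tendsto_0_iff h_def by auto
    have "((\<lambda>s. 2 * (LINT x|lborel. (h v t s x)\<^sup>2) + 2 * (LINT x|lborel. (h u t s x)\<^sup>2)) \<longlongrightarrow> 2 * 0 + 2 * 0) (at t within {0..})"
      by (intro tendsto_intros lim) auto
    then have lim2: "((\<lambda>s. 2 * (LINT x|lborel. (h v t s x)\<^sup>2) + 2 * (LINT x|lborel. (h u t s x)\<^sup>2)) \<longlongrightarrow> 0) (at t within {0..})"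
      by simp
    have bound: "norm (LINT x|lborel. (((v s x - u s x) - (v t x - u t x)) / (s - t) -
        (conv a (\<lambda>x. v t x - u t x) x - (1 + m) * (v t x - u t x)))\<^sup>2)
      \<le> 2 * (LINT x|lborel. (h v t s x)\<^sup>2) + 2 * (LINT x|lborel. (h u t s x)\<^sup>2)" if s: "s \<ge> 0" for s
    proof -
      have "((v s x - u s x) - (v t x - u t x)) / (s - t) - (conv a (\<lambda>x. v t x - u t x) x - (1 + m) * (v t x - u t x))
          = h v t s x + (- 1) * h u t s x" for x
      proof -
        note i = sq[OF t, THEN integrable_conv_integrand_L2, of x]
        show ?thesis
          unfolding h_def conv_diff[OF i] L0_eq_conv[OF i(1)] L0_eq_conv[OF i(2)]
          by (simp add: algebra_simps diff_divide_distrib add_divide_distrib)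
      qed
      then show ?thesis
        using integral_square_add_le[OF h_sq[of v s t] square_integrable_scale[OF h_sq[of u s t], of "- 1"]] sq s t
        by simp
    qed
    show "((\<lambda>s. LINT x|lborel. (((v s x - u s x) - (v t x - u t x)) / (s - t) -
        (conv a (\<lambda>x. v t x - u t x) x - (1 + m) * (v t x - u t x)))\<^sup>2) \<longlongrightarrow> 0) (at t within {0..})"
      by (rule Lim_null_comparison[OF _ lim2]) (use bound in \<open>auto simp: eventually_at intro!: exI[of _ 1]\<close>)
  qed (rule T)
  then show ?thesis by (simp add: u_def)
qed

text \<open>The difference w of two solutions satisfies a * w = (1 + m) w almost everywhere, and the
  L^2 contraction turns this into (1 + m)^2 times the square norm of w being at most that square
  norm, so w vanishes. Conversely, a change of v on a null set does not alter its convolution at any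
  point.\<close>

lemma L2_resolvent_iff:
  assumes v: "square_integrable v"
  shows "(AE x in lborel. m * v x - L0 a v x = apply_bcontfun f x) \<longleftrightarrow> (AE x in lborel. v x = apply_bcontfun N x)"
proof -
  have [measurable]: "v \<in> borel_measurable borel" using square_integrableD(1)[OF v] .
  have N_sq: "square_integrable (apply_bcontfun N)" by (rule square_integrable_bcontfun(1)[OF integrable_N])
  have N: "(1 + m) * apply_bcontfun N x - conv a (apply_bcontfun N) x = apply_bcontfun f x" for x
    using arg_cong[OF neumann_series_solves[of f], of "\<lambda>v. apply_bcontfun v x"] by (simp add: apply_conv_Cb)
  have L0: "L0 a v x = conv a v x - v x" for x
    by (rule L0_eq_conv[OF integrable_conv_integrand_L2[OF v]])
  show ?thesis
  proof
    assume eq: "AE x in lborel. v x = apply_bcontfun N x"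
    have "conv a v x = conv a (apply_bcontfun N) x" for x
      unfolding conv_def by (rule integral_cong_AE) (use eq in auto)
    then show "AE x in lborel. m * v x - L0 a v x = apply_bcontfun f x"
      using eq N by (auto simp: L0 algebra_simps)
  next
    define w where "w x = v x - apply_bcontfun N x" for x
    have w: "square_integrable w" unfolding w_def by (rule square_integrable_diff[OF v N_sq])
    assume "AE x in lborel. m * v x - L0 a v x = apply_bcontfun f x"
    then have "AE x in lborel. conv a w x = (1 + m) * w x"
    proof eventually_elim
      case (elim x)
      then show ?case
        using N[of x] conv_diff[OF integrable_conv_integrand_L2[OF v] integrable_conv_integrand_L2[OF N_sq], of x]
        by (simp add: w_def[abs_def] L0 algebra_simps)
    qed
    then have "(LINT x|lborel. (conv a w x)\<^sup>2) = (LINT x|lborel. ((1 + m) * w x)\<^sup>2)"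
      using square_integrableD(1)[OF w] square_integrableD(1)[OF square_integrable_conv[OF w]]
      by (intro integral_cong_AE) auto
    then have "(1 + m)\<^sup>2 * (LINT x|lborel. (w x)\<^sup>2) \<le> (LINT x|lborel. (w x)\<^sup>2)"
      using integral_conv_square_le[OF w] by (simp add: power_mult_distrib)
    then have "((1 + m)\<^sup>2 - 1) * (LINT x|lborel. (w x)\<^sup>2) \<le> 0" by (simp add: algebra_simps)
    moreover have "(1 + m)\<^sup>2 - 1 > 0" using m_pos by (simp add: power2_eq_square algebra_simps add_pos_pos)
    ultimately have "(LINT x|lborel. (w x)\<^sup>2) \<le> 0" by (auto simp: mult_le_0_iff)
    from integral_square_zero_AE[OF w this] show "AE x in lborel. v x = apply_bcontfun N x"
      by (simp add: w_def)
  qed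
qed

section \<open>Large-time limit\<close>

lemma norm_U_N_tendsto_0: "((\<lambda>t. norm (U t - N)) \<longlongrightarrow> 0) at_top"
proof (rule Lim_null_comparison)
  show "\<forall>\<^sub>F t in at_top. norm (norm (U t - N)) \<le> exp (- m * t) / m * norm f"
    using eventually_ge_at_top[of 0] by eventually_elim (use norm_duhamel_neumann[of _ f] in simp)
  show "((\<lambda>t. exp (- m * t) / m * norm f) \<longlongrightarrow> 0) at_top"
  proof -
    have "filterlim (\<lambda>t. - m * t) at_bot at_top"
      using m_pos by (intro filterlim_tendsto_neg_mult_at_bot[OF tendsto_const] filterlim_ident) auto
    then have "((\<lambda>t. exp (- m * t)) \<longlongrightarrow> 0) at_top"
      by (rule filterlim_compose[OF exp_at_bot])
    then have "((\<lambda>t. exp (- m * t) / m * norm f) \<longlongrightarrow> 0 / m * norm f) at_top"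
      using m_pos by (intro tendsto_intros) auto
    then show ?thesis by simp
  qed
qed

text \<open>Since U lies between 0 and N, the difference is dominated by N; this is an L^1 bound
  uniform in time.\<close>

lemma L2_norm_U_N_tendsto_0: "((\<lambda>t. L2_norm (apply_bcontfun (U t - N))) \<longlongrightarrow> 0) at_top"
proof (rule L2_norm_tendsto_0[OF _ norm_U_N_tendsto_0])
  show "\<forall>\<^sub>F t in at_top. integrable lborel (apply_bcontfun (U t - N)) \<and>
      (LINT x|lborel. \<bar>apply_bcontfun (U t - N) x\<bar>) \<le> (LINT x|lborel. apply_bcontfun N x)"
    using eventually_ge_at_top[of 0]
  proof eventually_elim
    case (elim t)
    have i: "integrable lborel (apply_bcontfun (U t - N))"
      using Bochner_Integration.integrable_diff[OF integrable_U[OF elim] integrable_N] by (simp add: minus_bcontfun.rep_eq)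
    moreover have "\<bar>apply_bcontfun (U t - N) x\<bar> \<le> apply_bcontfun N x" for x
      using U_bounds[OF elim, of x] by simp
    ultimately show ?case
      using integrable_N by (auto intro!: integral_mono)
  qed
qed

section \<open>Spatial decay of the stationary solution\<close>

text \<open>Two terms of the series suffice: k = 0 carries the decay of f, and k = 1 carries that of
  \<open>a\<close>, by restricting the convolution to y in the unit ball. The slower of the two
  decays is kept.\<close>

lemma N_power_lower_bound:
  assumes a_ge: "\<And>x. bm * (1 + norm x) powr (- p) \<le> a x" and f_ge: "\<And>x. bm' * (1 + norm x) powr (- q) \<le> apply_bcontfun f x"
    and b: "0 < bm" "0 < bm'" and p: "0 < p" and q: "0 < q"
  obtains cm where "0 < cm" "\<And>x. cm * (1 + norm x) powr (- min p q) \<le> apply_bcontfun N x"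
proof -
  let ?B = "cball (0::'a) 1"
  define M where "M = measure lborel ?B"
  have M: "0 < M" unfolding M_def by (rule content_cball_pos) simp
  \<comment> \<open>For |y| <= 1 one has 1 + |x - y| <= 2 (1 + |x|) and 1 + |y| <= 2, which gives
    the two powers of 2; M is the volume of the ball.\<close>
  define K where "K = bm * 2 powr (- p) * (bm' * 2 powr (- q)) * M"
  have K: "0 < K" using b M by (simp add: K_def)
  have 1: "K * (1 + norm x) powr (- p) \<le> iter 1 x" for x
  proof -
    have pt: "(bm * 2 powr (- p) * (1 + norm x) powr (- p)) * (bm' * 2 powr (- q)) * indicator ?B y
        \<le> a (x - y) * apply_bcontfun f y" for y
    proof (cases "y \<in> ?B")
      case True
      then have y: "norm y \<le> 1" by simp
      have "1 + norm (x - y) \<le> 1 + (norm x + 1)"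
        by (intro add_left_mono order_trans[OF norm_triangle_ineq4] y)
      also have "\<dots> \<le> 2 * (1 + norm x)" by simp
      finally have "1 + norm (x - y) \<le> 2 * (1 + norm x)" .
      then have "(2 * (1 + norm x)) powr (- p) \<le> (1 + norm (x - y)) powr (- p)"
        using p by (intro powr_mono2') (auto intro: add_pos_nonneg)
      then have "bm * (2 powr (- p) * (1 + norm x) powr (- p)) \<le> bm * (1 + norm (x - y)) powr (- p)"
        unfolding powr_mult using b by (intro mult_left_mono) auto
      then have "bm * 2 powr (- p) * (1 + norm x) powr (- p) \<le> a (x - y)"
        using a_ge[of "x - y"] by (simp add: mult.assoc)
      moreover have "bm' * 2 powr (- q) \<le> bm' * (1 + norm y) powr (- q)"
        using b y q by (intro mult_left_mono powr_mono2') (auto intro: add_pos_nonneg)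
      then have "bm' * 2 powr (- q) \<le> apply_bcontfun f y"
        using f_ge[of y] by linarith
      ultimately show ?thesis
        using True b nonneg by (auto intro: mult_mono)
    qed (simp add: nonneg f_nonneg)
    have "K * (1 + norm x) powr (- p)
        = (LINT y|lborel. (bm * 2 powr (- p) * (1 + norm x) powr (- p)) * (bm' * 2 powr (- q)) * indicator ?B y)"
      by (simp add: K_def M_def)
    also have "\<dots> \<le> (LINT y|lborel. a (x - y) * apply_bcontfun f y)"
    proof (rule integral_mono[OF _ integrable_conv_integrand_Cb pt])
      have "emeasure lborel ?B < \<infinity>" by (rule emeasure_bounded_finite) simp
      then show "integrable lborel (\<lambda>y. (bm * 2 powr (- p) * (1 + norm x) powr (- p)) * (bm' * 2 powr (- q)) * indicator ?B y)"
        by (intro integrable_mult_right) (simp add: integrable_indicator_iff)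
    qed
    also have "\<dots> = iter 1 x" by (simp add: iter_Suc iter_0 conv_def)
    finally show ?thesis .
  qed
  define cm where "cm = min (K / (1 + m)\<^sup>2) (bm' / (1 + m))"
  have cm: "0 < cm" using K b m_pos by (simp add: cm_def)
  have "cm * (1 + norm x) powr (- min p q) \<le> apply_bcontfun N x" for x
  proof (cases "p \<le> q")
    case True
    have "K * (1 + norm x) powr (- p) \<le> (1 + m)\<^sup>2 * apply_bcontfun N x"
      using 1[of x] iter_le_N[of 1 x] by (simp add: power2_eq_square)
    then have "K / (1 + m)\<^sup>2 * (1 + norm x) powr (- p) \<le> apply_bcontfun N x"
      using m_pos by (simp add: pos_divide_le_eq mult.commute)
    moreover have "cm * (1 + norm x) powr (- p) \<le> K / (1 + m)\<^sup>2 * (1 + norm x) powr (- p)"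
      by (rule mult_right_mono) (auto simp: cm_def)
    ultimately show ?thesis using True by (simp add: min_def)
  next
    case False
    have "bm' * (1 + norm x) powr (- q) \<le> (1 + m) * apply_bcontfun N x"
      using f_ge[of x] iter_le_N[of 0 x] by (simp add: iter_0)
    then have "bm' / (1 + m) * (1 + norm x) powr (- q) \<le> apply_bcontfun N x"
      using m_pos by (simp add: pos_divide_le_eq mult.commute)
    moreover have "cm * (1 + norm x) powr (- q) \<le> bm' / (1 + m) * (1 + norm x) powr (- q)"
      by (rule mult_right_mono) (auto simp: cm_def)
    ultimately show ?thesis using False by (simp add: min_def)
  qed
  with cm that show ?thesis by blast
qed

lemma N_power_upper_bound:
  assumes p: "0 < p" "p \<le> q" and a_le: "\<And>x. a x \<le> bp * (1 + norm x) powr (- q)"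
    and f_le: "\<And>x. apply_bcontfun f x \<le> bp' * (1 + norm x) powr (- p)"
    and int: "integrable lborel (\<lambda>x::'a. (1 + norm x) powr (- p))"
  obtains cp where "\<And>x. apply_bcontfun N x \<le> cp * (1 + norm x) powr (- p)"
proof -
  \<comment> \<open>The factor 1 + m / 2 lies midway between 1 and 1 + m, leaving the gap m / 2 as
    the denominator of the final constant.\<close>
  obtain l where l: "0 < l" "l \<le> 1" and
    super: "\<And>x. conv a (\<lambda>y. min l ((1 + norm y) powr (- p))) x \<le> (1 + m / 2) * min l ((1 + norm x) powr (- p))"
    using power_weight_supersolution[OF p a_le int, of "1 + m / 2"] m_pos by auto
  let ?\<omega> = "\<lambda>x::'a. (1 + norm x) powr (- p)"
  have \<omega>: "0 \<le> ?\<omega> x" "?\<omega> x \<le> 1" for x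
    using p powr_mono2'[of "- p" 1 "1 + norm x"] by auto
  have bp': "0 \<le> bp'"
    using f_le[of 0] f_nonneg[of 0] by simp
  \<comment> \<open>Capping costs at most the factor 1 / l: both l and the weight are at most 1, so
    l times the weight is below the capped weight.\<close>
  have f_le': "apply_bcontfun f x \<le> bp' / l * min l (?\<omega> x)" for x
  proof -
    have "l * ?\<omega> x \<le> min l (?\<omega> x)"
      using mult_left_mono[OF \<omega>(2)[of x], of l] mult_right_mono[OF l(2) \<omega>(1)[of x]] l by simp
    then have "bp' / l * (l * ?\<omega> x) \<le> bp' / l * min l (?\<omega> x)"
      using bp' l by (intro mult_left_mono) auto
    then show ?thesis using f_le[of x] l by simp
  qed
  let ?cp = "bp' / l / (1 + m - (1 + m / 2))"
  have "apply_bcontfun N x \<le> ?cp * min l (?\<omega> x)" for x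
    by (rule N_le_weight[where B = l and W = "\<lambda>x. min l (?\<omega> x)", OF _ _ _ super _ _ f_le'])
      (use l m_pos bp' \<omega> in auto)
  moreover have "?cp * min l (?\<omega> x) \<le> ?cp * ?\<omega> x" for x
    using l m_pos bp' by (intro mult_left_mono) auto
  ultimately show ?thesis using that order_trans by blast
qed

lemma N_exp_upper_bound:
  fixes b b' \<delta> \<delta>' :: real
  assumes pos: "0 < b'" "0 < \<delta>" "0 < \<delta>'"
    and a_le: "\<And>x. a x \<le> b * exp (- \<delta> * norm x)"
    and f_le: "\<And>x. apply_bcontfun f x \<le> b' * exp (- \<delta>' * norm x)"
  obtains K \<mu> where "0 < K" "0 < \<mu>" "\<And>x. apply_bcontfun N x \<le> K * exp (- \<mu> * norm x)"
proof -
  obtain \<mu> where \<mu>: "0 < \<mu>" "\<mu> \<le> \<delta>'" and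
    super: "\<And>x. conv a (\<lambda>y. exp (- \<mu> * norm y)) x \<le> (1 + m / 2) * exp (- \<mu> * norm x)"
    using exp_weight_supersolution[OF pos(2,3) a_le, of "1 + m / 2"] m_pos by auto
  \<comment> \<open>The rate was chosen no larger than that of f, so f lies below the slower
    exponential.\<close>
  have f_le': "apply_bcontfun f x \<le> b' * exp (- \<mu> * norm x)" for x
  proof -
    have "exp (- \<delta>' * norm x) \<le> exp (- \<mu> * norm x)"
      using mult_right_mono[OF \<mu>(2) norm_ge_zero[of x]] by simp
    then have "b' * exp (- \<delta>' * norm x) \<le> b' * exp (- \<mu> * norm x)"
      using pos by (intro mult_left_mono) auto
    then show ?thesis using f_le[of x] by linarith
  qed
  have "apply_bcontfun N x \<le> b' / (1 + m - (1 + m / 2)) * exp (- \<mu> * norm x)" for x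
    by (rule N_le_weight[where B = 1 and W = "\<lambda>x. exp (- \<mu> * norm x)", OF _ _ _ super _ _ f_le'])
      (use m_pos pos \<mu> in auto)
  moreover have "0 < b' / (1 + m - (1 + m / 2))" using m_pos pos by simp
  ultimately show ?thesis using that \<mu>(1) by blast
qed

end

theorem mainTheorem5:
  fixes a :: "'a::euclidean_space \<Rightarrow> real" and f :: "'a \<Rightarrow>\<^sub>C real" and m :: real
  assumes a_nonneg: "\<And>x. 0 \<le> a x"
    and a_bounded: "bounded (range a)"
    and a_cont: "continuous_on UNIV a"
    and a_even: "\<And>x. a (- x) = a x"
    and a_int: "integrable lborel a"
    and a_int_1: "(LINT x|lborel. a x) = 1"
    and m_pos: "m > 0"
    and f_int: "integrable lborel (apply_bcontfun f)"
    and f_nonneg: "\<And>x. 0 \<le> apply_bcontfun f x"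
    and f_nonzero: "\<exists>x. apply_bcontfun f x \<noteq> 0"
  defines "u \<equiv> cauchy_sol a m f"
    and "uh \<equiv> u_hat a m (apply_bcontfun f)"
  shows
    \<comment> \<open>\<open>u\<close> is the solution of the Cauchy problem, in \<open>C\<^sub>b\<close> and in \<open>L\<^sup>2\<close>\<close>
    "(is_cauchy_solution_Cb a m f u \<and>
      (\<forall>v. is_cauchy_solution_Cb a m f v \<longrightarrow> (\<forall>t\<ge>0. v t = u t)) \<and>
      is_cauchy_solution_L2 a m (apply_bcontfun f) (\<lambda>t. apply_bcontfun (u t)) \<and>
      (\<forall>v. is_cauchy_solution_L2 a m (apply_bcontfun f) v \<longrightarrow>
         (\<forall>t\<ge>0. AE x in lborel. v t x = apply_bcontfun (u t) x))) \<and>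
     \<comment> \<open>\<open>uh\<close> is \<open>(m - L\<^sub>0)\<close> inverse applied to \<open>f\<close>, in \<open>C\<^sub>b\<close> and in \<open>L\<^sup>2\<close>\<close>
     (uh \<in> bcontfun \<and>
      bij (\<lambda>v. m *\<^sub>R v - L0_Cb a v) \<and>
      inv (\<lambda>v. m *\<^sub>R v - L0_Cb a v) f = Bcontfun uh \<and>
      square_integrable uh \<and>
      (\<forall>v. square_integrable v \<longrightarrow>
         ((AE x in lborel. m * v x - L0 a v x = apply_bcontfun f x) \<longleftrightarrow>
          (AE x in lborel. v x = uh x)))) \<and>
     \<comment> \<open>(i)\<close>
     ((\<forall>t\<ge>0. square_integrable (\<lambda>x. apply_bcontfun (u t) x - uh x)) \<and>
      ((\<lambda>t. L2_norm (\<lambda>x. apply_bcontfun (u t) x - uh x)) \<longlongrightarrow> 0) at_top \<and>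
      ((\<lambda>t. norm (u t - Bcontfun uh)) \<longlongrightarrow> 0) at_top) \<and>
     \<comment> \<open>(ii)\<close>
     (\<forall>\<alpha> \<alpha>1 bm bp bm' bp' :: real.
        \<alpha> > 0 \<and> \<alpha>1 > 0 \<and> bm > 0 \<and> bp > 0 \<and> bm' > 0 \<and> bp' > 0 \<and>
        (\<forall>x. bm * (1 + norm x) powr (- (real DIM('a) + \<alpha>)) \<le> a x \<and>
             a x \<le> bp * (1 + norm x) powr (- (real DIM('a) + \<alpha>))) \<and>
        (\<forall>x. bm' * (1 + norm x) powr (- (real DIM('a) + \<alpha>1)) \<le> apply_bcontfun f x \<and>
             apply_bcontfun f x \<le> bp' * (1 + norm x) powr (- (real DIM('a) + \<alpha>1)))
        \<longrightarrow>
        (\<exists>cm cp :: real. 0 < cm \<and> cm \<le> cp \<and>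
           (\<forall>x. cm * (1 + norm x) powr (- (real DIM('a) + min \<alpha> \<alpha>1)) \<le> uh x \<and>
                uh x \<le> cp * (1 + norm x) powr (- (real DIM('a) + min \<alpha> \<alpha>1)))) \<and>
        (\<forall>x. \<forall>t>0. 0 \<le> apply_bcontfun (u t) x \<and> apply_bcontfun (u t) x \<le> uh x)) \<and>
     \<comment> \<open>(iii)\<close>
     (\<forall>b b' \<delta> \<delta>' :: real.
        b > 0 \<and> b' > 0 \<and> \<delta> > 0 \<and> \<delta>' > 0 \<and>
        (\<forall>x. a x \<le> b * exp (- \<delta> * norm x)) \<and>
        (\<forall>x. apply_bcontfun f x \<le> b' * exp (- \<delta>' * norm x))
        \<longrightarrow>
        (\<exists>K>0. \<exists>\<mu>>0. \<forall>x. \<bar>uh x\<bar> \<le> K * exp (- \<mu> * norm x)) \<and>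
        (\<forall>t>0. \<exists>K>0. \<exists>\<mu>>0. \<forall>x. \<bar>apply_bcontfun (u t) x\<bar> \<le> K * exp (- \<mu> * norm x)))"
proof -
  interpret cauchy_problem a m f
    by unfold_locales (use assms in auto)
  have uh: "uh = apply_bcontfun N"
    unfolding uh_def by (rule u_hat_eq_N)
  have BN: "Bcontfun uh = N"
    unfolding uh by (rule apply_bcontfun_inverse)
  have u: "u t = U t" if "t \<ge> 0" for t
    unfolding u_def by (rule cauchy_sol_eq[OF that])
  have resolvent: "(\<lambda>v. m *\<^sub>R v - L0_Cb a v) = (\<lambda>v. (1 + m) *\<^sub>R v - conv_Cb v)"
    by (simp add: conv_Cb_def scaleR_add_left)
  have u_bounds: "0 \<le> apply_bcontfun (u t) x" "apply_bcontfun (u t) x \<le> uh x" if "t > 0" for t x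
    using U_bounds[of t x] that u[of t] by (auto simp: uh)
  have ev: "\<forall>\<^sub>F t in at_top. U t = u t"
    using eventually_ge_at_top[of 0] by eventually_elim (simp add: u)
  have power: "(\<exists>cm cp. 0 < cm \<and> cm \<le> cp \<and>
      (\<forall>x. cm * (1 + norm x) powr (- (real DIM('a) + min \<alpha> \<alpha>1)) \<le> uh x \<and>
           uh x \<le> cp * (1 + norm x) powr (- (real DIM('a) + min \<alpha> \<alpha>1))))"
    if pos: "\<alpha> > 0" "\<alpha>1 > 0" "bm > 0" "bm' > 0"
      and a: "\<And>x. bm * (1 + norm x) powr (- (real DIM('a) + \<alpha>)) \<le> a x"
        "\<And>x. a x \<le> bp * (1 + norm x) powr (- (real DIM('a) + \<alpha>))"
      and f: "\<And>x. bm' * (1 + norm x) powr (- (real DIM('a) + \<alpha>1)) \<le> apply_bcontfun f x"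
        "\<And>x. apply_bcontfun f x \<le> bp' * (1 + norm x) powr (- (real DIM('a) + \<alpha>1))"
      and bp': "bp' > 0"
    for \<alpha> \<alpha>1 bm bp bm' bp'
  proof -
    let ?p = "real DIM('a) + \<alpha>" and ?q = "real DIM('a) + \<alpha>1" and ?r = "real DIM('a) + min \<alpha> \<alpha>1"
    have r: "min ?p ?q = ?r" by (simp add: min_def)
    \<comment> \<open>The integrability of the power weight is not computed: the lower bounds place
      the weights below multiples of the integrable functions \<open>a\<close> and f, and
      \<open>?r\<close> is one of their two exponents.\<close>
    have dominated: "integrable lborel (\<lambda>x::'a. (1 + norm x) powr (- s))"
      if "integrable lborel g" "\<beta> > 0" "\<And>x. \<beta> * (1 + norm x) powr (- s) \<le> g x" for g :: "'a \<Rightarrow> real" and \<beta> s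
    proof (rule Bochner_Integration.integrable_bound)
      show "integrable lborel (\<lambda>x. g x / \<beta>)" using that(1) by simp
      have le: "(1 + norm x) powr (- s) \<le> g x / \<beta>" for x
        using that(2) that(3)[of x] by (simp add: pos_le_divide_eq mult.commute)
      have "norm ((1 + norm x) powr (- s)) \<le> norm (g x / \<beta>)" for x
        using order_trans[OF le abs_ge_self] by simp
      then show "AE x in lborel. norm ((1 + norm x) powr (- s)) \<le> norm (g x / \<beta>)"
        by (rule AE_I2)
    qed measurable
    have r_int: "integrable lborel (\<lambda>x::'a. (1 + norm x) powr (- ?r))"
      using dominated[OF a_int pos(3) a(1)] dominated[OF f_int pos(4) f(1)] by (simp add: min_def)
    obtain cm where cm: "0 < cm" "\<And>x. cm * (1 + norm x) powr (- ?r) \<le> uh x"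
      using N_power_lower_bound[OF a(1) f(1) pos(3,4)] pos unfolding r uh by auto
    have f_le: "apply_bcontfun f x \<le> bp' * (1 + norm x) powr (- ?r)" for x
    proof -
      have "(1 + norm x) powr (- ?q) \<le> (1 + norm x) powr (- ?r)" by (rule powr_mono) auto
      then show ?thesis using f(2)[of x] bp' by (meson mult_left_mono less_imp_le order_trans)
    qed
    obtain cp where cp: "\<And>x. uh x \<le> cp * (1 + norm x) powr (- ?r)"
      unfolding uh by (rule N_power_upper_bound[OF _ _ a(2) f_le r_int]) (use pos in auto)
    \<comment> \<open>At the origin the weight equals 1, so the two bounds compare directly.\<close>
    have "cm \<le> cp" using cm(2)[of 0] cp[of 0] by simp
    with cm cp show ?thesis by blast
  qed
  have expo: "\<exists>K>0. \<exists>\<mu>>0. \<forall>x. \<bar>uh x\<bar> \<le> K * exp (- \<mu> * norm x)"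
    if "b' > 0" "\<delta> > 0" "\<delta>' > 0" "\<And>x. a x \<le> b * exp (- \<delta> * norm x)"
      "\<And>x. apply_bcontfun f x \<le> b' * exp (- \<delta>' * norm x)" for b b' \<delta> \<delta>'
  proof -
    note hyps = that
    obtain K \<mu> where "0 < K" "0 < \<mu>" "\<And>x. apply_bcontfun N x \<le> K * exp (- \<mu> * norm x)"
      by (rule N_exp_upper_bound[OF hyps]) blast
    \<comment> \<open>Nonnegativity of the stationary solution is read off from 0 <= u <=
      \<open>uh\<close> at time 1.\<close>
    moreover have "\<bar>uh x\<bar> = uh x" for x
      using u_bounds[of 1 x] by simp
    ultimately show ?thesis unfolding uh[symmetric] by (intro exI[of _ K] exI[of _ \<mu>] conjI allI) simp_all
  qed
  have expo_u: "\<exists>K>0. \<exists>\<mu>>0. \<forall>x. \<bar>apply_bcontfun (u t) x\<bar> \<le> K * exp (- \<mu> * norm x)"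
    if "\<exists>K>0. \<exists>\<mu>>0. \<forall>x. \<bar>uh x\<bar> \<le> K * exp (- \<mu> * norm x)" "t > 0" for t
  proof -
    have "\<bar>apply_bcontfun (u t) x\<bar> \<le> \<bar>uh x\<bar>" for x using u_bounds[OF that(2), of x] by simp
    then show ?thesis using that(1) by (meson order_trans)
  qed
  have Cb: "is_cauchy_solution_Cb a m f u"
    unfolding u_def by (rule is_cauchy_solution_Cb_cauchy_sol)
  have Cb_unique: "\<forall>v. is_cauchy_solution_Cb a m f v \<longrightarrow> (\<forall>t\<ge>0. v t = u t)"
    unfolding u_def using is_cauchy_solution_Cb_unique by blast
  have L2: "is_cauchy_solution_L2 a m (apply_bcontfun f) (\<lambda>t. apply_bcontfun (u t))"
    unfolding u_def by (rule is_cauchy_solution_L2_cauchy_sol)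
  have L2_unique: "\<forall>v. is_cauchy_solution_L2 a m (apply_bcontfun f) v \<longrightarrow>
         (\<forall>t\<ge>0. AE x in lborel. v t x = apply_bcontfun (u t) x)"
    unfolding u_def using is_cauchy_solution_L2_unique by blast
  have uh_Cb: "uh \<in> bcontfun" unfolding uh by (rule apply_bcontfun)
  have bij: "bij (\<lambda>v. m *\<^sub>R v - L0_Cb a v)" unfolding resolvent by (rule bij_resolvent)
  have inv: "inv (\<lambda>v. m *\<^sub>R v - L0_Cb a v) f = Bcontfun uh"
    unfolding resolvent BN by (rule inv_resolvent)
  have uh_sq: "square_integrable uh"
    unfolding uh by (rule square_integrable_bcontfun(1)[OF integrable_N])
  have inv_L2: "\<forall>v. square_integrable v \<longrightarrow>
         ((AE x in lborel. m * v x - L0 a v x = apply_bcontfun f x) \<longleftrightarrow> (AE x in lborel. v x = uh x))"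
    unfolding uh using L2_resolvent_iff by blast
  have diff_sq: "\<forall>t\<ge>0. square_integrable (\<lambda>x. apply_bcontfun (u t) x - uh x)"
    using square_integrable_diff[OF square_integrable_bcontfun(1)[OF integrable_U] uh_sq] u by simp
  have lim_L2: "((\<lambda>t. L2_norm (\<lambda>x. apply_bcontfun (u t) x - uh x)) \<longlongrightarrow> 0) at_top"
    by (rule Lim_transform_eventually[OF L2_norm_U_N_tendsto_0], use ev in eventually_elim)
      (simp add: uh minus_bcontfun.rep_eq)
  have lim_Cb: "((\<lambda>t. norm (u t - Bcontfun uh)) \<longlongrightarrow> 0) at_top"
    by (rule Lim_transform_eventually[OF norm_U_N_tendsto_0], use ev in eventually_elim) (simp add: BN)
  show ?thesis
  proof (intro conjI Cb Cb_unique L2 L2_unique uh_Cb bij inv uh_sq inv_L2 diff_sq lim_L2 lim_Cb, goal_cases)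
    case 1
    show ?case
    proof (intro allI impI, elim conjE, intro conjI allI impI, goal_cases)
      case (1 \<alpha> \<alpha>1 bm bp bm' bp')
      show ?case by (rule power[of \<alpha> \<alpha>1 bm bm' bp bp']) (use 1 in blast)+
    qed (simp_all add: u_bounds)
  next
    case 2
    show ?case
    proof (intro allI impI, elim conjE, intro conjI allI impI, goal_cases)
      case (1 b b' \<delta> \<delta>')
      show ?case by (rule expo[of b' \<delta> \<delta>' b]) (use 1 in blast)+
    next
      case (2 b b' \<delta> \<delta>' t)
      show ?case by (rule expo_u[OF expo[of b' \<delta> \<delta>' b]]) (use 2 in blast)+
    qed
  qed
qed

end
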